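(* Let $0 < q < p < \infty$, let $\varphi_1, \varphi_2$ be entire functions on $\mathbb{C}$ with $\varphi_1 \not\equiv \varphi_2$, and let $c_1, c_2$ be nonzero (complex) constants. The following conditions are equivalent. (i) $c_1 C_{\varphi_1} + c_2 C_{\varphi_2}: \mathcal{F}^p \to \mathcal{F}^q$ is bounded. (ii) $c_1 C_{\varphi_1} + c_2 C_{\varphi_2}: \mathcal{F}^p \to \mathcal{F}^q$ is compact. (iii) Both $C_{\varphi_1}: \mathcal{F}^p \to \mathcal{F}^q$ and $C_{\varphi_2}: \mathcal{F}^p \to \mathcal{F}^q$ are compact.
   Context: For $p \in (0,\infty)$, the Fock space $\mathcal{F}^p$ is the space of entire functions $f$ on $\mathbb{C}$ with $$\|f\|_p := \left( \frac{p}{2\pi} \int_{\mathbb{C}} |f(z)|^p e^{-\frac{p|z|^2}{2}}\, dA(z) \right)^{1/p} < \infty,$$ where $dA$ is Lebesgue measure on $\mathbb{C}$. For $p \geq 1$ it is a Banach space; for $0<p<1$ it is a complete metric space with distance $d(f,g) = \|f-g\|_p^p$. For an entire function $\varphi$, the composition operator $C_\varphi$ is defined on entire functions by $C_\varphi f = f \circ \varphi$. An operator is said to be bounded (respectively compact) from $\mathcal{F}^p$ to $\mathcal{F}^q$ if it maps $\mathcal{F}^p$ into $\mathcal{F}^q$ and maps the unit ball $\{f : \|f\|_p \le 1\}$ to a bounded (respectively relatively compact) subset of $\mathcal{F}^q$. *)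

theory Defs
  imports "HOL-Complex_Analysis.Complex_Analysis"
begin

section \<open>Fock spaces\<close>

definition fock_density :: "real \<Rightarrow> (complex \<Rightarrow> complex) \<Rightarrow> complex \<Rightarrow> real" where
  "fock_density p f z = cmod (f z) powr p * exp (- (p * (cmod z)\<^sup>2 / 2))"

text \<open>
  The Bochner integral is 0 for non-integrable functions, so \<open>fock_norm\<close> is meaningful only
  on \<open>fock_space\<close>, where finiteness of the norm is stated as integrability.
\<close>

definition fock_norm :: "real \<Rightarrow> (complex \<Rightarrow> complex) \<Rightarrow> real" where
  "fock_norm p f = (p / (2 * pi) * (\<integral>z. fock_density p f z \<partial>lborel)) powr (1 / p)"

definition fock_space :: "real \<Rightarrow> (complex \<Rightarrow> complex) set" where
  "fock_space p = {f. f holomorphic_on UNIV \<and> integrable lborel (fock_density p f)}"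

definition fock_unit_ball :: "real \<Rightarrow> (complex \<Rightarrow> complex) set" where
  "fock_unit_ball p = {f \<in> fock_space p. fock_norm p f \<le> 1}"

text \<open>The norm distance for \<open>p \<ge> 1\<close>, and its \<open>p\<close>-th power for \<open>0 < p < 1\<close>.\<close>

definition fock_dist :: "real \<Rightarrow> (complex \<Rightarrow> complex) \<Rightarrow> (complex \<Rightarrow> complex) \<Rightarrow> real" where
  "fock_dist p f g =
     (if p \<ge> 1 then fock_norm p (\<lambda>z. f z - g z) else fock_norm p (\<lambda>z. f z - g z) powr p)"


section \<open>Operators between Fock spaces\<close>

definition comp_op :: "(complex \<Rightarrow> complex) \<Rightarrow> (complex \<Rightarrow> complex) \<Rightarrow> complex \<Rightarrow> complex" where
  "comp_op \<phi> f = f \<circ> \<phi>"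

definition fock_bounded_op ::
  "real \<Rightarrow> real \<Rightarrow> ((complex \<Rightarrow> complex) \<Rightarrow> complex \<Rightarrow> complex) \<Rightarrow> bool" where
  "fock_bounded_op p q T \<longleftrightarrow>
     T ` fock_space p \<subseteq> fock_space q \<and>
     Metric_space.mbounded (fock_space q) (fock_dist q) (T ` fock_unit_ball p)"

definition fock_compact_op ::
  "real \<Rightarrow> real \<Rightarrow> ((complex \<Rightarrow> complex) \<Rightarrow> complex \<Rightarrow> complex) \<Rightarrow> bool" where
  "fock_compact_op p q T \<longleftrightarrow>
     T ` fock_space p \<subseteq> fock_space q \<and>
     compactin (Metric_space.mtopology (fock_space q) (fock_dist q))
       (Metric_space.mtopology (fock_space q) (fock_dist q) closure_of (T ` fock_unit_ball p))"


section \<open>\<open>fock_dist\<close> is a metric on the Fock space\<close>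

lemma fock_density_alt: "fock_density p f z = (cmod (f z) * exp (- ((cmod z)\<^sup>2 / 2))) powr p"
  by (simp add: fock_density_def powr_mult exp_powr_real mult.commute)

lemma fock_density_nonneg: "0 \<le> fock_density p f z"
  by (simp add: fock_density_def)

lemma fock_density_measurable:
  assumes "f holomorphic_on UNIV"
  shows "fock_density p f \<in> borel_measurable borel"
proof -
  have "f \<in> borel_measurable borel"
    using assms by (intro borel_measurable_continuous_onI holomorphic_on_imp_continuous_on)
  then show ?thesis
    unfolding fock_density_def[abs_def] by measurable
qed

lemma powr_add_le_subadd:
  fixes a b p :: real
  assumes "0 \<le> a" "0 \<le> b" "0 < p" "p \<le> 1"
  shows "(a + b) powr p \<le> a powr p + b powr p"
proof (cases "a + b = 0")
  case True
  then show ?thesis using assms by simp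
next
  case False
  then have s: "a + b > 0" using assms by simp
  have key: "x / (a + b) \<le> (x / (a + b)) powr p" if "0 \<le> x" "x \<le> a + b" for x
  proof (cases "x = 0")
    case nz: False
    then have "(x / (a + b)) powr 1 \<le> (x / (a + b)) powr p"
      using that s assms by (intro powr_mono') auto
    then show ?thesis using that s by simp
  qed simp
  have "1 = a / (a + b) + b / (a + b)" using s by (simp flip: add_divide_distrib)
  also have "\<dots> \<le> (a / (a + b)) powr p + (b / (a + b)) powr p"
    using key[of a] key[of b] assms by auto
  also have "\<dots> = (a powr p + b powr p) / (a + b) powr p"
    using assms s by (simp add: powr_divide add_divide_distrib)
  finally show ?thesis using s by (simp add: field_simps)
qed

lemma powr_add_le_convex:
  fixes a b A B p :: real
  assumes "0 \<le> a" "0 \<le> b" "0 < A" "0 < B" "1 \<le> p"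
  shows "(a + b) powr p \<le>
    (A + B) powr p * (A / (A + B) * (a powr p / A powr p) + B / (A + B) * (b powr p / B powr p))"
proof -
  define s where "s = A / (A + B)"
  define t where "t = B / (A + B)"
  have st: "s + t = 1" "0 < s" "0 < t" "s \<le> 1" "t \<le> 1"
    using assms by (auto simp: s_def t_def simp flip: add_divide_distrib)
  have le: "c powr p \<le> c" if "0 < c" "c \<le> 1" for c :: real
    using powr_mono'[of 1 p c] that assms by simp
  have conv: "(s * x + t * y) powr p \<le> s * x powr p + t * y powr p"
    if xy: "0 \<le> x" "0 \<le> y" for x y
  proof -
    consider "x = 0" | "y = 0" | "0 < x" "0 < y" using xy by fastforce
    then show ?thesis
    proof cases
      case 1
      then show ?thesis using st xy assms le[of t] by (simp add: powr_mult mult_right_mono)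
    next
      case 2
      then show ?thesis using st xy assms le[of s] by (simp add: powr_mult mult_right_mono)
    next
      case 3
      have s: "1 - t = s" using st by simp
      show ?thesis
        using convex_onD[OF powr_convex[OF assms(5)], of t x y] st 3
        unfolding s by simp
    qed
  qed
  have scale: "(A + B) * s = A" "(A + B) * t = B"
    using assms by (auto simp: s_def t_def)
  have "a + b = (A + B) * s * (a / A) + (A + B) * t * (b / B)"
    unfolding scale using assms by simp
  also have "\<dots> = (A + B) * (s * (a / A) + t * (b / B))"
    by (simp only: distrib_left mult.assoc)
  finally have "(a + b) powr p = ((A + B) * (s * (a / A) + t * (b / B))) powr p"
    by simp
  also have "\<dots> = (A + B) powr p * (s * (a / A) + t * (b / B)) powr p"
    using assms st by (intro powr_mult)
  also have "\<dots> \<le> (A + B) powr p * (s * (a / A) powr p + t * (b / B) powr p)"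
    using assms by (intro mult_left_mono conv) auto
  finally show ?thesis
    using assms by (simp add: s_def t_def powr_divide)
qed

lemma fock_density_triangle:
  fixes f g :: "complex \<Rightarrow> complex"
  assumes "0 < p" "p \<le> 1"
  shows "fock_density p (\<lambda>z. f z + g z) z \<le> fock_density p f z + fock_density p g z"
proof -
  have "fock_density p (\<lambda>z. f z + g z) z
      \<le> (cmod (f z) * exp (- ((cmod z)\<^sup>2 / 2)) + cmod (g z) * exp (- ((cmod z)\<^sup>2 / 2))) powr p"
    unfolding fock_density_alt using assms
    by (intro powr_mono2) (auto simp: norm_triangle_ineq mult_right_mono simp flip: distrib_right)
  also have "\<dots> \<le> fock_density p f z + fock_density p g z"
    unfolding fock_density_alt using assms by (intro powr_add_le_subadd) auto
  finally show ?thesis .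
qed

lemma fock_density_convex:
  fixes f g :: "complex \<Rightarrow> complex"
  assumes "1 \<le> p" "0 < A" "0 < B"
  shows "fock_density p (\<lambda>z. f z + g z) z \<le>
    (A + B) powr p * (A / (A + B) * (fock_density p f z / A powr p)
                    + B / (A + B) * (fock_density p g z / B powr p))"
proof -
  have "fock_density p (\<lambda>z. f z + g z) z
      \<le> (cmod (f z) * exp (- ((cmod z)\<^sup>2 / 2)) + cmod (g z) * exp (- ((cmod z)\<^sup>2 / 2))) powr p"
    unfolding fock_density_alt using assms
    by (intro powr_mono2) (auto simp: norm_triangle_ineq mult_right_mono simp flip: distrib_right)
  also have "\<dots> \<le> (A + B) powr p * (A / (A + B) * (fock_density p f z / A powr p)
                    + B / (A + B) * (fock_density p g z / B powr p))"
    unfolding fock_density_alt using assms by (intro powr_add_le_convex) auto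
  finally show ?thesis .
qed

lemma fock_space_add:
  assumes p: "0 < p" and f: "f \<in> fock_space p" and g: "g \<in> fock_space p"
  shows "(\<lambda>z. f z + g z) \<in> fock_space p"
proof -
  have hol: "(\<lambda>z. f z + g z) holomorphic_on UNIV"
    using f g by (auto simp: fock_space_def intro: holomorphic_on_add)
  have int: "integrable lborel (fock_density p f)" "integrable lborel (fock_density p g)"
    using f g by (auto simp: fock_space_def)
  have "\<exists>h. integrable lborel h \<and> (\<forall>z. fock_density p (\<lambda>z. f z + g z) z \<le> h z)"
  proof (cases "p \<le> 1")
    case True
    then show ?thesis
      using int p fock_density_triangle[of p f g]
      by (intro exI[of _ "\<lambda>z. fock_density p f z + fock_density p g z"]) auto
  next
    case False
    then show ?thesis
      using int fock_density_convex[of p 1 1 f g]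
      by (intro exI[of _ "\<lambda>z. (1 + 1) powr p * (1 / (1 + 1) * (fock_density p f z / 1 powr p)
                    + 1 / (1 + 1) * (fock_density p g z / 1 powr p))"]) auto
  qed
  then obtain h where h: "integrable lborel h" "\<And>z. fock_density p (\<lambda>z. f z + g z) z \<le> h z"
    by auto
  have "integrable lborel (fock_density p (\<lambda>z. f z + g z))"
  proof (rule Bochner_Integration.integrable_bound[OF h(1)])
    show "fock_density p (\<lambda>z. f z + g z) \<in> borel_measurable lborel"
      using fock_density_measurable[OF hol] by simp
    show "AE z in lborel. norm (fock_density p (\<lambda>z. f z + g z) z) \<le> norm (h z)"
      using h(2) fock_density_nonneg by (intro AE_I2) (smt (verit) real_norm_def)
  qed
  with hol show ?thesis by (simp add: fock_space_def)
qed

lemma fock_space_diff: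
  assumes p: "0 < p" and f: "f \<in> fock_space p" and g: "g \<in> fock_space p"
  shows "(\<lambda>z. f z - g z) \<in> fock_space p"
proof -
  have "fock_density p (\<lambda>z. - g z) = fock_density p g"
    by (simp add: fock_density_def fun_eq_iff)
  then have "(\<lambda>z. - g z) \<in> fock_space p"
    using g by (auto simp: fock_space_def intro: holomorphic_on_minus)
  from fock_space_add[OF p f this] show ?thesis by simp
qed

lemma fock_norm_powr:
  assumes "0 < p"
  shows "fock_norm p f powr p = p / (2 * pi) * (\<integral>z. fock_density p f z \<partial>lborel)"
proof -
  have "0 \<le> (\<integral>z. fock_density p f z \<partial>lborel)"
    by (simp add: fock_density_nonneg)
  then show ?thesis
    using assms by (simp add: fock_norm_def powr_powr)
qed

lemma fock_norm_powr_triangle: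
  assumes p: "0 < p" "p \<le> 1" and f: "f \<in> fock_space p" and g: "g \<in> fock_space p"
  shows "fock_norm p (\<lambda>z. f z + g z) powr p \<le> fock_norm p f powr p + fock_norm p g powr p"
proof -
  have "(\<integral>z. fock_density p (\<lambda>z. f z + g z) z \<partial>lborel)
      \<le> (\<integral>z. fock_density p f z + fock_density p g z \<partial>lborel)"
    using f g fock_space_add[OF p(1) f g] fock_density_triangle[OF p]
    by (intro integral_mono) (auto simp: fock_space_def)
  also have "\<dots> = (\<integral>z. fock_density p f z \<partial>lborel) + (\<integral>z. fock_density p g z \<partial>lborel)"
    using f g by (intro Bochner_Integration.integral_add) (auto simp: fock_space_def)
  finally show ?thesis
    using p by (simp add: fock_norm_powr divide_simps distrib_left[symmetric])
qed

lemma fock_norm_triangle: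
  assumes p: "1 \<le> p" and f: "f \<in> fock_space p" and g: "g \<in> fock_space p"
  shows "fock_norm p (\<lambda>z. f z + g z) \<le> fock_norm p f + fock_norm p g"
proof -
  have main: "fock_norm p (\<lambda>z. f z + g z) \<le> A + B"
    if A: "fock_norm p f < A" and B: "fock_norm p g < B" for A B
  proof -
    let ?K = "p / (2 * pi)"
    let ?I = "\<lambda>f. \<integral>z. fock_density p f z \<partial>lborel"
    have nn: "0 \<le> fock_norm p f" "0 \<le> fock_norm p g" "0 \<le> fock_norm p (\<lambda>z. f z + g z)"
      by (simp_all add: fock_norm_def)
    have AB: "0 < A" "0 < B" using A B nn by linarith+
    have If: "?K * ?I f \<le> A powr p" and Ig: "?K * ?I g \<le> B powr p"
      using A B nn p fock_norm_powr[of p f] fock_norm_powr[of p g]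
        powr_mono2[of p "fock_norm p f" A] powr_mono2[of p "fock_norm p g" B] by auto
    have "?I (\<lambda>z. f z + g z) \<le>
        (\<integral>z. (A + B) powr p * (A / (A + B) * (fock_density p f z / A powr p)
                    + B / (A + B) * (fock_density p g z / B powr p)) \<partial>lborel)"
      using f g fock_space_add[OF _ f g] fock_density_convex[OF p AB] p
      by (intro integral_mono) (auto simp: fock_space_def)
    also have "\<dots> = (A + B) powr p * (A / (A + B) * (?I f / A powr p) + B / (A + B) * (?I g / B powr p))"
      using f g by (simp add: fock_space_def)
    finally have "?K * ?I (\<lambda>z. f z + g z)
      \<le> ?K * ((A + B) powr p * (A / (A + B) * (?I f / A powr p) + B / (A + B) * (?I g / B powr p)))"
      using p by (intro mult_left_mono) auto
    also have "\<dots> = (A + B) powr p * (A / (A + B) * (?K * ?I f / A powr p)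
                                       + B / (A + B) * (?K * ?I g / B powr p))"
      by (simp add: algebra_simps)
    also have "\<dots> \<le> (A + B) powr p * (A / (A + B) * 1 + B / (A + B) * 1)"
      using If Ig AB by (intro mult_left_mono add_mono) (auto simp: field_simps)
    also have "\<dots> = (A + B) powr p"
      using AB by (simp flip: add_divide_distrib)
    finally have "fock_norm p (\<lambda>z. f z + g z) powr p \<le> (A + B) powr p"
      using p by (simp add: fock_norm_powr)
    then show ?thesis
      using AB nn p by (metis add_pos_pos less_eq_real_def linorder_not_le order_less_le_trans
          powr_less_mono2 zero_less_one)
  qed
  show ?thesis
  proof (rule field_le_epsilon)
    fix e :: real assume "0 < e"
    then show "fock_norm p (\<lambda>z. f z + g z) \<le> fock_norm p f + fock_norm p g + e"
      using main[of "fock_norm p f + e / 2" "fock_norm p g + e / 2"] by simp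
  qed
qed

lemma fock_norm_eq_0_iff:
  assumes p: "0 < p" and f: "f \<in> fock_space p"
  shows "fock_norm p f = 0 \<longleftrightarrow> (\<forall>z. f z = 0)"
proof
  assume "fock_norm p f = 0"
  then have "(\<integral>z. fock_density p f z \<partial>lborel) = 0"
    using p by (simp add: fock_norm_def)
  then have "AE z in lborel. fock_density p f z = 0"
    using f by (subst (asm) integral_nonneg_eq_0_iff_AE)
      (auto simp: fock_space_def fock_density_nonneg)
  then have ae: "AE z in lborel. f z = 0"
    by (simp add: fock_density_def)
  have cont: "continuous_on UNIV f"
    using f by (auto simp: fock_space_def intro: holomorphic_on_imp_continuous_on)
  have op: "open {z. f z \<noteq> 0}"
    by (intro open_Collect_neq cont continuous_on_const)
  have "{z. f z \<noteq> 0} \<in> null_sets lborel"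
    using ae op by (subst (asm) AE_iff_null) auto
  then have "negligible {z. f z \<noteq> 0}"
    by (simp add: negligible_iff_null_sets null_sets_completionI)
  then show "\<forall>z. f z = 0"
    using open_not_negligible[OF op] by auto
next
  assume "\<forall>z. f z = 0"
  then show "fock_norm p f = 0"
    using p by (simp add: fock_norm_def fock_density_def)
qed

lemma Metric_space_fock:
  assumes p: "0 < p"
  shows "Metric_space (fock_space p) (fock_dist p)"
proof
  show "0 \<le> fock_dist p f g" for f g
    by (simp add: fock_dist_def fock_norm_def)
  show "fock_dist p f g = fock_dist p g f" for f g
    by (simp add: fock_dist_def fock_norm_def fock_density_def norm_minus_commute)
  show "fock_dist p f g = 0 \<longleftrightarrow> f = g" if "f \<in> fock_space p" "g \<in> fock_space p" for f g
    using fock_norm_eq_0_iff[OF p fock_space_diff[OF p that]]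
    by (auto simp: fock_dist_def fun_eq_iff)
  show "fock_dist p f h \<le> fock_dist p f g + fock_dist p g h"
    if "f \<in> fock_space p" "g \<in> fock_space p" "h \<in> fock_space p" for f g h
  proof -
    have d: "(\<lambda>z. f z - g z) \<in> fock_space p" "(\<lambda>z. g z - h z) \<in> fock_space p"
      using fock_space_diff[OF p] that by auto
    show ?thesis
      using fock_norm_triangle[OF _ d] fock_norm_powr_triangle[OF p _ d]
      by (simp add: fock_dist_def)
  qed
qed

end

theory Submission
  imports Defs "HOL-Real_Asymp.Real_Asymp"
begin

text \<open>
  Let \<open>T\<close> be the combination of the two composition operators and suppose it is bounded. Testing it
  on the kernels \<open>exp (z * cnj w)\<close> with \<open>w\<close> near \<open>\<phi>\<^sub>i z\<close> gives
  \<open>min 1 \<bar>\<phi>\<^sub>1 z - \<phi>\<^sub>2 z\<bar> * exp (\<bar>\<phi>\<^sub>i z\<bar>\<^sup>2 / 2) \<le> C * exp (\<bar>z\<bar>\<^sup>2 / 2)\<close>. By Liouville's theorem first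
  \<open>\<phi>\<^sub>1 - \<phi>\<^sub>2\<close> and then both symbols are affine, and \<open>\<phi>\<^sub>i z = a\<^sub>i * z + b\<^sub>i\<close> has \<open>\<bar>a\<^sub>i\<bar> < 1\<close>, or
  \<open>\<bar>a\<^sub>i\<bar> = 1\<close> and \<open>b\<^sub>i = 0\<close>. The latter is excluded by the monomials \<open>z ^ n\<close>, for which the quotient of
  the \<open>q\<close>-norm by the \<open>p\<close>-norm grows like \<open>n powr (1 / (2 * q) - 1 / (2 * p))\<close>. Conversely, when
  \<open>\<bar>a\<^sub>i\<bar> < 1\<close>, the images of the unit ball are dominated by one function
  \<open>K * exp (\<bar>z\<bar>\<^sup>2 / 2 - d * \<bar>z\<bar>\<^sup>2)\<close> with \<open>d > 0\<close>, and Montel's theorem with dominated convergence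
  gives compactness.
\<close>

subsection \<open>Pointwise growth\<close>

text \<open>
  Replaces subharmonicity of \<open>\<bar>F\<bar> powr q\<close>, uniformly in \<open>q > 0\<close>. At a maximum \<open>z0\<close> of
  \<open>(1 - dist c z) powr (2 / q) * \<bar>F z\<bar>\<close> on the unit disc, \<open>\<bar>F\<bar>\<close> is at most a constant times
  \<open>\<bar>F z0\<bar>\<close> near \<open>z0\<close>, so Cauchy's estimate keeps it above \<open>\<bar>F z0\<bar> / 2\<close> on a smaller disc.
\<close>

lemma entire_large_on_ball:
  fixes q :: real
  assumes q: "0 < q"
  obtains \<kappa> where "0 < \<kappa>"
    "\<And>F c. F holomorphic_on UNIV \<Longrightarrow> \<exists>w \<rho>. 0 < \<rho> \<and> ball w \<rho> \<subseteq> ball c 1 \<and>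
        (\<forall>z\<in>ball w \<rho>. \<kappa> * cmod (F c) powr q \<le> \<rho>\<^sup>2 * cmod (F z) powr q)"
proof -
  define K :: real where "K = 2 powr (2 / q)"
  have K1: "1 \<le> K" unfolding K_def using q by (intro ge_one_powr_ge_zero) auto
  \<comment> \<open>The factor \<open>(1 / 2) powr q\<close> pays for the lower bound
    \<open>cmod (F z0) / 2\<close>, and \<open>64 * K\<^sup>2\<close> comes from squaring the radius
    \<open>d / (8 * K)\<close> chosen below.\<close>
  define \<kappa> :: real where "\<kappa> = (1 / 2) powr q / (64 * K\<^sup>2)"
  have "0 < \<kappa>" using K1 by (auto simp: \<kappa>_def)
  moreover have "\<exists>w \<rho>. 0 < \<rho> \<and> ball w \<rho> \<subseteq> ball c 1 \<and>
        (\<forall>z\<in>ball w \<rho>. \<kappa> * cmod (F c) powr q \<le> \<rho>\<^sup>2 * cmod (F z) powr q)"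
    if hol: "F holomorphic_on UNIV" for F c
  proof (cases "F c = 0")
    case True
    then show ?thesis
      by (intro exI[of _ c] exI[of _ 1]) simp
  next
    case False
    \<comment> \<open>With the exponent \<open>2 / q\<close>, the \<open>q\<close>-th power of the
      weight is the squared distance to the boundary, which matches the area of the disc found below
      for every \<open>q\<close>.\<close>
    define h where "h z = (1 - dist c z) powr (2 / q) * cmod (F z)" for z
    have contF: "continuous_on S F" for S
      using hol holomorphic_on_imp_continuous_on continuous_on_subset by blast
    have "continuous_on (cball c 1) h"
      unfolding h_def using q by (intro continuous_intros contF continuous_on_powr') auto
    from continuous_attains_sup[OF compact_cball _ this]
    obtain z0 where z0: "z0 \<in> cball c 1" and max: "\<And>z. z \<in> cball c 1 \<Longrightarrow> h z \<le> h z0"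
      by fastforce
    define d where "d = 1 - dist c z0"
    have hc: "cmod (F c) \<le> h z0" using max[of c] by (simp add: h_def)
    then have "0 < h z0" using False by (smt (verit) zero_less_norm_iff)
    then have d0: "0 < d"
      using z0 q by (auto simp: h_def d_def zero_less_mult_iff less_le)
    \<comment> \<open>Within \<open>d / 2\<close> of \<open>z0\<close> the distance to the boundary
      is still at least \<open>d / 2\<close>, so maximality of \<open>h\<close> loses only
      \<open>K\<close>, the ratio of the two weights.\<close>
    have upper: "cmod (F z) \<le> K * cmod (F z0)" if z: "dist z0 z \<le> d / 2" for z
    proof -
      have a: "d / 2 \<le> 1 - dist c z"
        using z dist_triangle[of c z z0] by (simp add: d_def)
      then have "(d / 2) powr (2 / q) * cmod (F z) \<le> h z"
        unfolding h_def using d0 q by (intro mult_right_mono powr_mono2) auto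
      also have "\<dots> \<le> h z0" using max[of z] a d0 by auto
      also have "\<dots> = (d / 2) powr (2 / q) * (K * cmod (F z0))"
        using d0 by (simp add: h_def K_def d_def[symmetric] powr_divide)
      finally show ?thesis using d0 by simp
    qed
    \<comment> \<open>Cauchy's estimate with radius \<open>d / 4\<close> bounds the derivative by
      \<open>4 * K * cmod (F z0) / d\<close>; over a distance \<open>\<rho>\<close> the function
      then changes by at most \<open>cmod (F z0) / 2\<close>.\<close>
    define \<rho> where "\<rho> = d / (8 * K)"
    have \<rho>0: "0 < \<rho>" using d0 K1 by (simp add: \<rho>_def)
    have "\<rho> \<le> d / 8" unfolding \<rho>_def using d0 K1 by (intro divide_left_mono) auto
    then have \<rho>d: "\<rho> \<le> d / 4" using d0 by simp
    have deriv: "cmod (deriv F z) \<le> 4 * K * cmod (F z0) / d" if z: "z \<in> ball z0 \<rho>" for z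
    proof -
      have "norm ((deriv ^^ 1) F z) \<le> fact 1 * (K * cmod (F z0)) / (d / 4) ^ 1"
      proof (rule Cauchy_inequality)
        show "F holomorphic_on ball z (d / 4)" using hol holomorphic_on_subset by blast
        show "cmod (F x) \<le> K * cmod (F z0)" if "cmod (z - x) = d / 4" for x
        proof (rule upper)
          show "dist z0 x \<le> d / 2"
            using dist_triangle[of z0 x z] that z \<rho>d by (simp add: dist_norm)
        qed
      qed (use d0 contF in auto)
      then show ?thesis by (simp add: field_simps)
    qed
    have lower: "cmod (F z0) / 2 \<le> cmod (F z)" if z: "z \<in> ball z0 \<rho>" for z
    proof -
      have "cmod (F z0 - F z) \<le> 4 * K * cmod (F z0) / d * cmod (z0 - z)"
      proof (rule field_differentiable_bound)
        show "(F has_field_derivative deriv F x) (at x within ball z0 \<rho>)" for x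
          using holomorphic_derivI[OF hol] by (simp add: has_field_derivative_at_within)
      qed (use deriv z \<rho>0 in auto)
      also have "\<dots> \<le> 4 * K * cmod (F z0) / d * \<rho>"
        using z d0 K1 by (intro mult_left_mono) (auto simp: dist_norm)
      also have "\<dots> = cmod (F z0) / 2" using d0 K1 by (simp add: \<rho>_def)
      finally show ?thesis
        using norm_triangle_ineq2[of "F z0" "F z"] by linarith
    qed
    have hp: "h z0 powr q = d\<^sup>2 * cmod (F z0) powr q"
      using q d0 by (simp add: h_def d_def[symmetric] powr_mult powr_powr)
    have main: "\<kappa> * cmod (F c) powr q \<le> \<rho>\<^sup>2 * cmod (F z) powr q" if z: "z \<in> ball z0 \<rho>" for z
    proof -
      have "\<kappa> * cmod (F c) powr q \<le> \<kappa> * h z0 powr q"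
        using hc q \<open>0 < \<kappa>\<close> by (intro mult_left_mono powr_mono2) auto
      also have "\<dots> = \<rho>\<^sup>2 * (cmod (F z0) / 2) powr q"
        using K1 by (simp add: hp \<kappa>_def \<rho>_def powr_divide power_divide power_mult_distrib)
      also have "\<dots> \<le> \<rho>\<^sup>2 * cmod (F z) powr q"
        using lower[OF z] q by (intro mult_left_mono powr_mono2) auto
      finally show ?thesis .
    qed
    have "ball z0 \<rho> \<subseteq> ball c 1"
    proof
      fix z assume "z \<in> ball z0 \<rho>"
      then have "dist z0 z < \<rho>" by simp
      then show "z \<in> ball c 1"
        using dist_triangle[of c z z0] \<rho>d d0 unfolding d_def by simp
    qed
    with main \<rho>0 show ?thesis by blast
  qed
  ultimately show ?thesis using that by blast
qed

lemma pi_r2_ball: "0 \<le> r \<Longrightarrow> measure lborel (ball (z::complex) r) = pi * r\<^sup>2"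
  using content_ball[of r z] by (simp add: unit_ball_vol_2)

text \<open>Multiplication by \<open>exp (- ((\<zeta> - c) * cnj c))\<close> recentres the Gaussian
  weight at \<open>c\<close>: \<open>cmod (F z) * exp (- (cmod c)\<^sup>2 / 2)\<close> is
  \<open>cmod (f z) * exp (- (cmod z)\<^sup>2 / 2)\<close> times
  \<open>exp ((cmod (z - c))\<^sup>2 / 2)\<close>, and the last factor lies between 1 and
  \<open>exp (1 / 2)\<close> on the unit disc around \<open>c\<close>. A disc on which
  \<open>F\<close> is large thus contributes at least a constant multiple of the density at
  \<open>c\<close>.\<close>

lemma fock_pointwise:
  fixes p :: real
  assumes p: "0 < p"
  obtains C where "0 < C"
    "\<And>f z. f \<in> fock_space p \<Longrightarrow> fock_density p f z \<le> C * (\<integral>z. fock_density p f z \<partial>lborel)"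
proof -
  from entire_large_on_ball[OF p] obtain \<kappa> where \<kappa>: "0 < \<kappa>"
    "\<And>F c. F holomorphic_on UNIV \<Longrightarrow> \<exists>w \<rho>. 0 < \<rho> \<and> ball w \<rho> \<subseteq> ball c 1 \<and>
        (\<forall>z\<in>ball w \<rho>. \<kappa> * cmod (F c) powr p \<le> \<rho>\<^sup>2 * cmod (F z) powr p)"
    by blast
  define C where "C = exp (p / 2) / (pi * \<kappa>)"
  have "0 < C" using \<kappa>(1) by (simp add: C_def)
  moreover have "fock_density p f c \<le> C * (\<integral>z. fock_density p f z \<partial>lborel)"
    if f: "f \<in> fock_space p" for f c
  proof -
    define F where "F \<zeta> = f \<zeta> * exp (- ((\<zeta> - c) * cnj c))" for \<zeta>
    have "F holomorphic_on UNIV"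
      unfolding F_def using f by (auto simp: fock_space_def intro!: holomorphic_intros)
    from \<kappa>(2)[OF this, of c] obtain w \<rho> where \<rho>: "0 < \<rho>" "ball w \<rho> \<subseteq> ball c 1"
      and low: "\<And>z. z \<in> ball w \<rho> \<Longrightarrow> \<kappa> * cmod (F c) powr p \<le> \<rho>\<^sup>2 * cmod (F z) powr p"
      by auto
    \<comment> \<open>\<open>D * (pi * \<rho>\<^sup>2)\<close> no longer depends on
      \<open>\<rho>\<close>, so the constant is uniform in \<open>f\<close> and \<open>c\<close>
      although the disc is not.\<close>
    define D where "D = \<kappa> * exp (- (p / 2)) / \<rho>\<^sup>2 * fock_density p f c"
    have D: "D \<le> fock_density p f z" if z: "z \<in> ball w \<rho>" for z
    proof -
      have "dist c z < 1" using z \<rho>(2) by auto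
      then have dz: "(cmod (z - c))\<^sup>2 \<le> 1"
        by (simp add: dist_norm norm_minus_commute abs_square_le_1)
      define R where "R = Re ((z - c) * cnj c)"
      have sq: "(cmod z)\<^sup>2 = (cmod c)\<^sup>2 + 2 * R + (cmod (z - c))\<^sup>2"
        unfolding cmod_power2 R_def by (simp add: power2_eq_square algebra_simps)
      have "\<kappa> * fock_density p f c = \<kappa> * cmod (F c) powr p * exp (- (p * (cmod c)\<^sup>2 / 2))"
        by (simp add: F_def fock_density_def)
      also have "\<dots> \<le> \<rho>\<^sup>2 * cmod (F z) powr p * exp (- (p * (cmod c)\<^sup>2 / 2))"
        by (intro mult_right_mono low z) auto
      also have "cmod (F z) = cmod (f z) * exp (- R)"
        unfolding F_def norm_mult norm_exp_eq_Re R_def by simp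
      also have "\<dots> powr p = cmod (f z) powr p * exp (- (p * R))"
        by (simp add: powr_mult exp_powr_real mult.commute)
      also have "\<rho>\<^sup>2 * (cmod (f z) powr p * exp (- (p * R))) * exp (- (p * (cmod c)\<^sup>2 / 2))
          = \<rho>\<^sup>2 * cmod (f z) powr p * exp (- (p * R) - p * (cmod c)\<^sup>2 / 2)"
        by (simp only: mult.assoc exp_add[symmetric] diff_conv_add_uminus)
      also have "- (p * R) - p * (cmod c)\<^sup>2 / 2 = - (p * (cmod z)\<^sup>2 / 2) + p * (cmod (z - c))\<^sup>2 / 2"
        unfolding sq by (simp add: algebra_simps add_divide_distrib)
      also have "\<rho>\<^sup>2 * cmod (f z) powr p * exp \<dots>
          = \<rho>\<^sup>2 * fock_density p f z * exp (p * (cmod (z - c))\<^sup>2 / 2)"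
        unfolding fock_density_def exp_add by simp
      also have "\<dots> \<le> \<rho>\<^sup>2 * fock_density p f z * exp (p / 2)"
        using dz p by (intro mult_left_mono) (auto simp: fock_density_nonneg mult_left_le)
      finally have *: "\<kappa> * fock_density p f c \<le> \<rho>\<^sup>2 * fock_density p f z * exp (p / 2)" .
      have "D * (\<rho>\<^sup>2 * exp (p / 2)) = \<kappa> * fock_density p f c"
        using \<rho>(1) by (simp add: D_def exp_minus field_simps)
      with * have "D * (\<rho>\<^sup>2 * exp (p / 2)) \<le> fock_density p f z * (\<rho>\<^sup>2 * exp (p / 2))"
        by (simp add: mult.commute mult.left_commute)
      then show ?thesis using \<rho>(1) by simp
    qed
    have "D * (pi * \<rho>\<^sup>2) = (\<integral>z. indicator (ball w \<rho>) z * D \<partial>lborel)"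
      using \<rho>(1) by (simp add: pi_r2_ball mult.commute)
    also have "\<dots> \<le> (\<integral>z. fock_density p f z \<partial>lborel)"
    proof (rule integral_mono)
      show "integrable lborel (\<lambda>z. indicator (ball w \<rho>) z * D)"
        by (intro integrable_mult_left integrable_real_indicator) (use emeasure_lborel_ball_finite[of w \<rho>] in auto)
      show "integrable lborel (fock_density p f)" using f by (simp add: fock_space_def)
      show "indicator (ball w \<rho>) z * D \<le> fock_density p f z" for z
        using D[of z] fock_density_nonneg[of p f z] by (simp add: indicator_def)
    qed
    finally have I: "D * (pi * \<rho>\<^sup>2) \<le> (\<integral>z. fock_density p f z \<partial>lborel)" .
    have "fock_density p f c = C * (D * (pi * \<rho>\<^sup>2))"
      using \<rho>(1) \<kappa>(1) by (simp add: C_def D_def exp_minus field_simps)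
    also have "\<dots> \<le> C * (\<integral>z. fock_density p f z \<partial>lborel)"
      using I \<open>0 < C\<close> by simp
    finally show ?thesis .
  qed
  ultimately show ?thesis using that by blast
qed

subsection \<open>Gaussian integrals and monomials\<close>

lemma emeasure_annulus:
  assumes "0 \<le> r" "r \<le> R"
  shows "emeasure lborel (ball (z::complex) R - ball z r) = ennreal (pi * (R\<^sup>2 - r\<^sup>2))"
proof -
  have fin: "emeasure lborel (ball z t) \<noteq> \<infinity>" for t
    using emeasure_lborel_ball_finite[of z t] by simp
  have "emeasure lborel (ball z R - ball z r) = emeasure lborel (ball z R) - emeasure lborel (ball z r)"
    using assms fin[of r] by (intro emeasure_Diff) auto
  also have "\<dots> = ennreal (pi * R\<^sup>2) - ennreal (pi * r\<^sup>2)"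
    using assms fin[of R] fin[of r]
    by (simp add: emeasure_eq_ennreal_measure pi_r2_ball)
  also have "\<dots> = ennreal (pi * (R\<^sup>2 - r\<^sup>2))"
    by (subst ennreal_minus) (auto simp: right_diff_distrib)
  finally show ?thesis .
qed

text \<open>The integrand is concentrated in an annulus of bounded width around the circle of radius
  \<open>s\<close>, whose area is of order \<open>1 + s\<close>. The plane is covered by annuli of
  half-width \<open>j + 1\<close>, and the Gaussian decay in \<open>j\<close> beats their area,
  which is at most \<open>4 * pi * (1 + s) * (j + 1)\<^sup>2\<close>.\<close>

lemma integral_exp_annulus:
  fixes p :: real
  assumes p: "0 < p"
  obtains C where "0 < C"
    "\<And>s. 0 \<le> s \<Longrightarrow> integrable lborel (\<lambda>z::complex. exp (- (p * (cmod z - s)\<^sup>2 / 2)))"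
    "\<And>s. 0 \<le> s \<Longrightarrow> (\<integral>z. exp (- (p * (cmod z - s)\<^sup>2 / 2)) \<partial>lborel) \<le> C * (1 + s)"
proof -
  define e where "e j = exp (- (p * (real j)\<^sup>2 / 2))" for j
  define S where "S = (\<Sum>j. e j * (real j + 1)\<^sup>2)"
  have summ: "summable (\<lambda>j. e j * (real j + 1)\<^sup>2)"
  proof (rule summable_comparison_test_bigo)
    show "summable (\<lambda>j. norm (1 / real j ^ 2))"
      using inverse_power_summable[of 2, where 'a = real] by (simp add: inverse_eq_divide)
    show "(\<lambda>j. e j * (real j + 1)\<^sup>2) \<in> O(\<lambda>j. 1 / real j ^ 2)"
      unfolding e_def using p by real_asymp
  qed
  have S0: "0 \<le> S" unfolding S_def e_def by (intro suminf_nonneg summ[unfolded e_def]) auto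
  define C where "C = 4 * pi * S + 1"
  have C0: "0 < C" using S0 by (simp add: C_def add_nonneg_pos)
  have nn: "(\<integral>\<^sup>+z. ennreal (exp (- (p * (cmod z - s)\<^sup>2 / 2))) \<partial>lborel) \<le> ennreal (C * (1 + s))"
    if s: "0 \<le> s" for s
  proof -
    \<comment> \<open>The sets increase with \<open>j\<close> instead of being disjoint; for an
      upper bound it suffices that a point with
      \<open>j \<le> \<bar>cmod z - s\<bar> < j + 1\<close> lies in \<open>A j\<close>.\<close>
    define A :: "nat \<Rightarrow> complex set"
      where "A j = ball 0 (s + (j + 1)) - ball 0 (max 0 (s - (j + 1)))" for j
    have Ameas [measurable]: "A j \<in> sets borel" for j by (simp add: A_def)
    have mA: "emeasure lborel (A j) \<le> ennreal (4 * pi * (1 + s) * (real j + 1)\<^sup>2)" for j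
    proof -
      define r where "r = max 0 (s - (real j + 1))"
      have r: "0 \<le> r" "r \<le> s + (real j + 1)" using s by (auto simp: r_def)
      have "(s + (real j + 1))\<^sup>2 - r\<^sup>2 \<le> 4 * (1 + s) * (real j + 1)\<^sup>2"
      proof (cases "s \<ge> real j + 1")
        case True
        then have "(s + (real j + 1))\<^sup>2 - r\<^sup>2 = 4 * s * (real j + 1)"
          by (simp add: r_def power2_eq_square algebra_simps)
        also have "\<dots> \<le> 4 * (1 + s) * (real j + 1)\<^sup>2"
          using s by (intro mult_mono) (auto simp: power2_eq_square)
        finally show ?thesis .
      next
        case False
        have "(s + (real j + 1))\<^sup>2 - r\<^sup>2 \<le> (s + (real j + 1)) * (s + (real j + 1))"
          by (simp add: power2_eq_square)
        also have "\<dots> \<le> ((1 + s) * (real j + 1)) * (2 * (real j + 1))"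
          using s False by (intro mult_mono) (auto simp: algebra_simps)
        also have "\<dots> \<le> 4 * (1 + s) * (real j + 1)\<^sup>2"
          using s by (simp add: power2_eq_square algebra_simps)
        finally show ?thesis .
      qed
      then have *: "pi * ((s + (real j + 1))\<^sup>2 - r\<^sup>2) \<le> 4 * pi * (1 + s) * (real j + 1)\<^sup>2"
        by (simp add: mult.assoc mult.left_commute)
      have "emeasure lborel (A j) = ennreal (pi * ((s + (real j + 1))\<^sup>2 - r\<^sup>2))"
        unfolding A_def r_def using r by (subst emeasure_annulus) (auto simp: r_def ac_simps)
      also have "\<dots> \<le> ennreal (4 * pi * (1 + s) * (real j + 1)\<^sup>2)"
        using * by (rule ennreal_leI)
      finally show ?thesis .
    qed
    have pt: "ennreal (exp (- (p * (cmod z - s)\<^sup>2 / 2))) \<le> (\<Sum>j. ennreal (e j) * indicator (A j) z)" for z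
    proof -
      define j where "j = nat \<lfloor>\<bar>cmod z - s\<bar>\<rfloor>"
      have j: "real j \<le> \<bar>cmod z - s\<bar>" "\<bar>cmod z - s\<bar> < real j + 1"
        by (auto simp: j_def)
      then have zA: "z \<in> A j" by (auto simp: A_def max_def)
      have "(real j)\<^sup>2 \<le> (cmod z - s)\<^sup>2"
        using j(1) by (metis of_nat_0_le_iff power2_abs power_mono)
      then have "exp (- (p * (cmod z - s)\<^sup>2 / 2)) \<le> e j"
        using p by (simp add: e_def)
      then have "ennreal (exp (- (p * (cmod z - s)\<^sup>2 / 2))) \<le> ennreal (e j) * indicator (A j) z"
        using zA by (simp add: ennreal_leI)
      also have "\<dots> \<le> (\<Sum>i. ennreal (e i) * indicator (A i) z)"
      proof -
        define g where "g i = ennreal (e i) * indicator (A i) z" for i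
        have "sum g {j} \<le> suminf g" by (intro sum_le_suminf) auto
        then have "g j \<le> suminf g" by simp
        then show ?thesis by (simp only: g_def[abs_def])
      qed
      finally show ?thesis .
    qed
    have "(\<integral>\<^sup>+z. ennreal (exp (- (p * (cmod z - s)\<^sup>2 / 2))) \<partial>lborel)
        \<le> (\<integral>\<^sup>+z. (\<Sum>j. ennreal (e j) * indicator (A j) z) \<partial>lborel)"
      by (intro nn_integral_mono pt)
    also have "\<dots> = (\<Sum>j. ennreal (e j) * emeasure lborel (A j))"
      by (subst nn_integral_suminf) (auto simp: nn_integral_cmult_indicator)
    also have "\<dots> \<le> (\<Sum>j. ennreal (4 * pi * (1 + s) * (e j * (real j + 1)\<^sup>2)))"
    proof (intro suminf_le)
      fix j
      have "ennreal (e j) * emeasure lborel (A j) \<le> ennreal (e j) * ennreal (4 * pi * (1 + s) * (real j + 1)\<^sup>2)"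
        by (intro mult_left_mono mA) auto
      also have "\<dots> = ennreal (4 * pi * (1 + s) * (e j * (real j + 1)\<^sup>2))"
        by (subst ennreal_mult'[symmetric]) (auto simp: e_def mult_ac)
      finally show "ennreal (e j) * emeasure lborel (A j) \<le> \<dots>" .
    qed auto
    also have "\<dots> = ennreal (\<Sum>j. 4 * pi * (1 + s) * (e j * (real j + 1)\<^sup>2))"
      using s by (intro suminf_ennreal2 summable_mult summ) (auto simp: e_def)
    also have "(\<Sum>j. 4 * pi * (1 + s) * (e j * (real j + 1)\<^sup>2)) = 4 * pi * (1 + s) * S"
      unfolding S_def using summ by (rule suminf_mult)
    also have "ennreal \<dots> \<le> ennreal (C * (1 + s))"
      using s by (intro ennreal_leI) (simp add: C_def algebra_simps)
    finally show ?thesis .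
  qed
  have "integrable lborel (\<lambda>z::complex. exp (- (p * (cmod z - s)\<^sup>2 / 2)))" if "0 \<le> s" for s
    using nn[OF that] by (intro integrableI_bounded) (auto simp: le_less_trans)
  moreover have "(\<integral>z. exp (- (p * (cmod z - s)\<^sup>2 / 2)) \<partial>lborel) \<le> C * (1 + s)"
    if "0 \<le> s" for s
    using nn[OF that] C0 that by (intro integral_real_bounded) auto
  ultimately show ?thesis using that C0 by blast
qed

lemma integrable_gaussian:
  assumes "0 < c"
  shows "integrable lborel (\<lambda>z::complex. exp (- (c * (cmod z)\<^sup>2)))"
proof -
  from assms have "0 < 2 * c" by simp
  from integral_exp_annulus[OF this] obtain C where
    "\<And>s. 0 \<le> s \<Longrightarrow> integrable lborel (\<lambda>z::complex. exp (- (2 * c * (cmod z - s)\<^sup>2 / 2)))"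
    by blast
  from this[of 0] show ?thesis by simp
qed

text \<open>The radial weight \<open>r ^ n * exp (- r\<^sup>2 / 2)\<close> peaks at \<open>r = sqrt n\<close> with width of order 1, so the
  integral of the density of \<open>z ^ n\<close> is the \<open>p\<close>-th power of the peak value times \<open>sqrt n\<close>, up to
  constants. This extra \<open>sqrt n\<close> is what separates the exponents \<open>p\<close> and \<open>q\<close>.\<close>

lemma monomial_weight_upper:
  fixes r :: real
  assumes n: "1 \<le> n" and r: "0 \<le> r"
  shows "r ^ n * exp (- (r\<^sup>2 / 2)) \<le>
    sqrt n ^ n * exp (- (real n / 2)) * exp (- ((r - sqrt n)\<^sup>2 / 2))"
proof -
  define s where "s = sqrt n"
  have s: "0 < s" "s * s = n" using n by (auto simp: s_def)
  \<comment> \<open>This is \<open>1 + x \<le> exp x\<close> at \<open>x = r / s - 1\<close>. Since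
    \<open>n = s * s\<close>, the exponent becomes \<open>s * r - s * s\<close>, which completes the
    square with \<open>- r\<^sup>2 / 2\<close>.\<close>
  have "(r / s) ^ n \<le> exp (r / s - 1) ^ n"
    using exp_ge_add_one_self[of "r / s - 1"] s r by (intro power_mono) auto
  also have "\<dots> = exp (s * s * (r / s - 1))"
    using s by (simp add: exp_of_nat_mult)
  also have "s * s * (r / s - 1) = s * r - s * s" using s by (simp add: field_simps)
  finally have "r ^ n \<le> s ^ n * exp (s * r - s * s)"
    using s by (simp add: power_divide field_simps)
  then have "r ^ n * exp (- (r\<^sup>2 / 2)) \<le> s ^ n * exp (s * r - s * s) * exp (- (r\<^sup>2 / 2))"
    by (intro mult_right_mono) auto
  also have "\<dots> = s ^ n * exp (s * r - s * s - r\<^sup>2 / 2)"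
    by (simp only: mult.assoc exp_add[symmetric] diff_conv_add_uminus)
  also have "s * r - s * s - r\<^sup>2 / 2 = - (s * s / 2) - (r - s)\<^sup>2 / 2"
    by (simp add: power2_eq_square field_simps)
  also have "s ^ n * exp \<dots> = s ^ n * exp (- (real n / 2)) * exp (- ((r - s)\<^sup>2 / 2))"
    unfolding s(2) by (simp only: mult.assoc exp_add[symmetric] diff_conv_add_uminus)
  finally show ?thesis by (simp add: s_def)
qed

text \<open>With \<open>s = sqrt n\<close> and \<open>r = s + t\<close>, the bound
  \<open>x - x\<^sup>2 \<le> ln (1 + x)\<close> at \<open>x = t / s\<close> leaves the peak value
  times \<open>exp (- 3 / 2 * t\<^sup>2)\<close>: one \<open>t\<^sup>2\<close> is lost in the
  logarithm and half of one in \<open>r\<^sup>2 / 2\<close>. On an annulus of width 1 this is a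
  constant factor.\<close>

lemma monomial_weight_lower:
  fixes r :: real
  assumes n: "1 \<le> n" and r: "sqrt n \<le> r" "r \<le> sqrt n + 1"
  shows "sqrt n ^ n * exp (- (real n / 2)) * exp (- (3 / 2)) \<le> r ^ n * exp (- (r\<^sup>2 / 2))"
proof -
  define s where "s = sqrt n"
  have s: "1 \<le> s" "s * s = n" using n by (auto simp: s_def)
  define t where "t = r - s"
  have t: "0 \<le> t" "t \<le> 1" using r by (auto simp: t_def s_def)
  have tt: "t * t \<le> 1" using t by (simp add: mult_le_one)
  have ts: "0 \<le> t / s" "t / s \<le> 1" using t s by auto
  have "exp (t / s - (t / s)\<^sup>2) \<le> 1 + t / s"
    using ln_one_plus_pos_lower_bound[OF ts] ts by (simp add: ln_ge_iff add_pos_nonneg)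
  then have "exp (t / s - (t / s)\<^sup>2) ^ n \<le> (r / s) ^ n"
    using s by (intro power_mono) (auto simp: t_def field_simps)
  also have "exp (t / s - (t / s)\<^sup>2) ^ n = exp (s * s * (t / s - (t / s)\<^sup>2))"
    using s by (simp add: exp_of_nat_mult)
  also have "s * s * (t / s - (t / s)\<^sup>2) = s * t - t * t"
    using s(1) by (simp add: field_simps power2_eq_square)
  finally have "s ^ n * exp (s * t - t * t) \<le> r ^ n"
    using s by (simp add: power_divide field_simps)
  note power_bound = this
  have "s ^ n * exp (- (real n / 2)) * exp (- (3 / 2)) = s ^ n * exp (- (s * s / 2) + - (3 / 2))"
    unfolding s(2) by (simp only: mult.assoc exp_add)
  also have "\<dots> \<le> s ^ n * exp (- (s * s / 2) - 3 / 2 * (t * t))"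
    using s(1) tt by (intro mult_left_mono) auto
  also have "- (s * s / 2) - 3 / 2 * (t * t) = (s * t - t * t) + - (r\<^sup>2 / 2)"
    by (simp add: t_def power2_eq_square field_simps)
  also have "s ^ n * exp \<dots> = s ^ n * exp (s * t - t * t) * exp (- (r\<^sup>2 / 2))"
    by (simp only: mult.assoc exp_add)
  also have "\<dots> \<le> r ^ n * exp (- (r\<^sup>2 / 2))"
    by (intro mult_right_mono power_bound) auto
  finally show ?thesis by (simp add: s_def)
qed

lemma fock_density_monomial:
  "fock_density p (\<lambda>z. z ^ n) z = (cmod z ^ n * exp (- ((cmod z)\<^sup>2 / 2))) powr p"
  by (simp add: fock_density_alt norm_power)

text \<open>The \<open>p\<close>-th power of the weight is at most that of the peak value times a
  Gaussian in \<open>cmod z - sqrt n\<close>, so \<open>integral_exp_annulus\<close> applies with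
  \<open>s = sqrt n\<close>. The same domination gives membership.\<close>

lemma fock_monomial_upper:
  fixes p :: real
  assumes p: "0 < p"
  obtains C where "0 < C"
    "\<And>n. 1 \<le> n \<Longrightarrow> (\<lambda>z. z ^ n) \<in> fock_space p"
    "\<And>n. 1 \<le> n \<Longrightarrow> (\<integral>z. fock_density p (\<lambda>z. z ^ n) z \<partial>lborel)
        \<le> (sqrt n ^ n * exp (- (real n / 2))) powr p * (C * (1 + sqrt n))"
proof -
  from integral_exp_annulus[OF p] obtain C where C: "0 < C"
    "\<And>s. 0 \<le> s \<Longrightarrow> integrable lborel (\<lambda>z::complex. exp (- (p * (cmod z - s)\<^sup>2 / 2)))"
    "\<And>s. 0 \<le> s \<Longrightarrow> (\<integral>z. exp (- (p * (cmod z - s)\<^sup>2 / 2)) \<partial>lborel) \<le> C * (1 + s)"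
    by blast
  have pt: "fock_density p (\<lambda>z. z ^ n) z \<le>
      (sqrt n ^ n * exp (- (real n / 2))) powr p * exp (- (p * (cmod z - sqrt n)\<^sup>2 / 2))"
    if n: "1 \<le> n" for n z
  proof -
    have "fock_density p (\<lambda>z. z ^ n) z \<le>
      (sqrt n ^ n * exp (- (real n / 2)) * exp (- ((cmod z - sqrt n)\<^sup>2 / 2))) powr p"
      unfolding fock_density_monomial
      using monomial_weight_upper[OF n, of "cmod z"] p by (intro powr_mono2) auto
    also have "\<dots> = (sqrt n ^ n * exp (- (real n / 2))) powr p * exp (- (p * (cmod z - sqrt n)\<^sup>2 / 2))"
      by (subst powr_mult) (simp add: exp_powr_real mult.commute)
    finally show ?thesis .
  qed
  have dom: "integrable lborel (\<lambda>z::complex. (sqrt n ^ n * exp (- (real n / 2))) powr p *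
      exp (- (p * (cmod z - sqrt n)\<^sup>2 / 2)))" for n :: nat
    by (intro integrable_mult_right C(2)) auto
  have mem: "(\<lambda>z. z ^ n) \<in> fock_space p" if n: "1 \<le> n" for n
  proof -
    have hol: "(\<lambda>z::complex. z ^ n) holomorphic_on UNIV" by (intro holomorphic_intros)
    have "integrable lborel (fock_density p (\<lambda>z. z ^ n))"
      by (rule Bochner_Integration.integrable_bound[OF dom])
        (use pt[OF n] fock_density_measurable[OF hol] in \<open>auto simp: fock_density_nonneg\<close>)
    with hol show ?thesis by (simp add: fock_space_def)
  qed
  moreover have "(\<integral>z. fock_density p (\<lambda>z. z ^ n) z \<partial>lborel)
      \<le> (sqrt n ^ n * exp (- (real n / 2))) powr p * (C * (1 + sqrt n))" if n: "1 \<le> n" for n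
  proof -
    have "(\<integral>z. fock_density p (\<lambda>z. z ^ n) z \<partial>lborel) \<le>
      (\<integral>z. (sqrt n ^ n * exp (- (real n / 2))) powr p *
        exp (- (p * (cmod z - sqrt n)\<^sup>2 / 2)) \<partial>lborel)"
      using mem[OF n] pt[OF n] dom by (intro integral_mono) (auto simp: fock_space_def)
    also have "\<dots> = (sqrt n ^ n * exp (- (real n / 2))) powr p *
        (\<integral>z. exp (- (p * (cmod z - sqrt n)\<^sup>2 / 2)) \<partial>lborel)"
      by simp
    also have "\<dots> \<le> (sqrt n ^ n * exp (- (real n / 2))) powr p * (C * (1 + sqrt n))"
      by (intro mult_left_mono C(3)) auto
    finally show ?thesis .
  qed
  ultimately show ?thesis using that C(1) by blast
qed

text \<open>Only the annulus of width 1 outside the peak circle is used: there the weight stays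
  comparable to its peak, and the area \<open>pi * (2 * sqrt n + 1)\<close> supplies the factor
  \<open>sqrt n\<close>.\<close>

lemma fock_monomial_lower:
  fixes q :: real
  assumes q: "0 < q" and n: "1 \<le> n" and mem: "(\<lambda>z. z ^ n) \<in> fock_space q"
  shows "(sqrt n ^ n * exp (- (real n / 2))) powr q * (exp (- (3 / 2 * q)) * (2 * pi * sqrt n))
    \<le> (\<integral>z. fock_density q (\<lambda>z. z ^ n) z \<partial>lborel)"
proof -
  define A :: "complex set" where "A = ball 0 (sqrt n + 1) - ball 0 (sqrt n)"
  define D where "D = (sqrt n ^ n * exp (- (real n / 2))) powr q * exp (- (3 / 2 * q))"
  have D0: "0 \<le> D" by (simp add: D_def)
  have eA: "emeasure lborel A = ennreal (pi * ((sqrt n + 1)\<^sup>2 - (sqrt n)\<^sup>2))"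
    unfolding A_def by (rule emeasure_annulus) auto
  then have mA: "measure lborel A = pi * ((sqrt n + 1)\<^sup>2 - (sqrt n)\<^sup>2)"
    by (simp add: measure_def power_mono del: real_sqrt_pow2)
  have fin: "emeasure lborel A < \<infinity>" by (simp add: eA)
  have pt: "D \<le> fock_density q (\<lambda>z. z ^ n) z" if "z \<in> A" for z
  proof -
    have "D = (sqrt n ^ n * exp (- (real n / 2)) * exp (- (3 / 2))) powr q"
      unfolding D_def by (subst powr_mult) (simp add: exp_powr_real mult.commute)
    also have "\<dots> \<le> fock_density q (\<lambda>z. z ^ n) z"
      unfolding fock_density_monomial using that q
      by (intro powr_mono2 monomial_weight_lower[OF n]) (auto simp: A_def)
    finally show ?thesis .
  qed
  have "D * (2 * pi * sqrt n) \<le> D * measure lborel A"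
    unfolding mA by (intro mult_left_mono D0) (simp add: power2_eq_square algebra_simps)
  also have "\<dots> = (\<integral>z. indicator A z * D \<partial>lborel)" by (simp add: mult.commute A_def)
  also have "\<dots> \<le> (\<integral>z. fock_density q (\<lambda>z. z ^ n) z \<partial>lborel)"
  proof (rule integral_mono)
    show "integrable lborel (\<lambda>z. indicator A z * D)"
      using fin by (intro integrable_mult_left integrable_real_indicator) (auto simp: A_def)
    show "indicator A z * D \<le> fock_density q (\<lambda>z. z ^ n) z" for z
      using pt[of z] by (simp add: indicator_def fock_density_nonneg)
  qed (use mem in \<open>simp add: fock_space_def\<close>)
  finally show ?thesis by (simp add: D_def mult_ac)
qed

text \<open>The \<open>p\<close>-th root of the pointwise bound, with the weight moved to the right.
  Admitting any upper bound \<open>I\<close> of the integral lets norm estimates be inserted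
  directly.\<close>

lemma fock_growth:
  fixes p :: real
  assumes p: "0 < p"
  obtains C where "0 < C"
    "\<And>f z I. f \<in> fock_space p \<Longrightarrow> (\<integral>z. fock_density p f z \<partial>lborel) \<le> I \<Longrightarrow>
        cmod (f z) \<le> (C * I) powr (1 / p) * exp ((cmod z)\<^sup>2 / 2)"
proof -
  from fock_pointwise[OF p] obtain C where C: "0 < C"
    "\<And>f z. f \<in> fock_space p \<Longrightarrow> fock_density p f z \<le> C * (\<integral>z. fock_density p f z \<partial>lborel)"
    by blast
  have "cmod (f z) \<le> (C * I) powr (1 / p) * exp ((cmod z)\<^sup>2 / 2)"
    if f: "f \<in> fock_space p" and I: "(\<integral>z. fock_density p f z \<partial>lborel) \<le> I" for f z I
  proof -
    define u where "u = cmod (f z) * exp (- ((cmod z)\<^sup>2 / 2))"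
    have "u powr p \<le> C * I"
      using C(2)[OF f, of z] mult_left_mono[OF I, of C] C(1)
      unfolding u_def fock_density_alt[symmetric] by linarith
    then have "(u powr p) powr (1 / p) \<le> (C * I) powr (1 / p)"
      using p by (intro powr_mono2) auto
    moreover have "(u powr p) powr (1 / p) = u" using p by (simp add: powr_powr u_def)
    ultimately have "u \<le> (C * I) powr (1 / p)" by simp
    then show ?thesis by (simp add: u_def exp_minus field_simps)
  qed
  with C(1) that show ?thesis by blast
qed

subsection \<open>Compactness for affine contractions\<close>

text \<open>Completing a square absorbs the cross term \<open>2 * (A * B * r)\<close> into half of
  the gap \<open>\<eta> = 1 - A\<^sup>2\<close>, at the cost of a constant. The other half remains
  as the Gaussian decay \<open>2 * c\<close>.\<close>

lemma affine_contraction_growth: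
  fixes a b :: complex
  assumes a: "cmod a < 1"
  obtains c L :: real where "0 < c" "0 < L"
    "\<And>z. exp ((cmod (a * z + b))\<^sup>2 / 2) \<le> L * exp ((cmod z)\<^sup>2 / 2 - c * (cmod z)\<^sup>2)"
proof -
  define A B where "A = cmod a" and "B = cmod b"
  define \<eta> where "\<eta> = 1 - A\<^sup>2"
  have AB: "0 \<le> A" "0 \<le> B" by (auto simp: A_def B_def)
  have \<eta>: "0 < \<eta>" using a by (simp add: \<eta>_def A_def abs_square_less_1)
  define c where "c = \<eta> / 4"
  define M where "M = 2 * A\<^sup>2 * B\<^sup>2 / \<eta> + B\<^sup>2"
  have le: "(cmod (a * z + b))\<^sup>2 \<le> (cmod z)\<^sup>2 - 2 * c * (cmod z)\<^sup>2 + M" for z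
  proof -
    define r where "r = cmod z"
    have "cmod (a * z + b) \<le> A * r + B"
      unfolding A_def B_def r_def by (metis norm_mult norm_triangle_ineq)
    then have "(cmod (a * z + b))\<^sup>2 \<le> (A * r + B)\<^sup>2" by (intro power_mono) auto
    also have "\<dots> = A\<^sup>2 * r\<^sup>2 + 2 * (A * B * r) + B\<^sup>2" by (simp add: power2_eq_square algebra_simps)
    also have "2 * (A * B * r) \<le> \<eta> / 2 * r\<^sup>2 + 2 * A\<^sup>2 * B\<^sup>2 / \<eta>"
    proof -
      have "0 \<le> \<eta> / 2 * (r - 2 * A * B / \<eta>)\<^sup>2" using \<eta> by auto
      also have "\<dots> = \<eta> / 2 * r\<^sup>2 + 2 * A\<^sup>2 * B\<^sup>2 / \<eta> - 2 * (A * B * r)"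
        using \<eta> by (simp add: power2_eq_square field_simps)
      finally show ?thesis by simp
    qed
    also have "A\<^sup>2 * r\<^sup>2 + (\<eta> / 2 * r\<^sup>2 + 2 * A\<^sup>2 * B\<^sup>2 / \<eta>) + B\<^sup>2 = r\<^sup>2 - 2 * c * r\<^sup>2 + M"
      by (simp add: \<eta>_def c_def M_def field_simps)
    finally show ?thesis by (simp add: r_def)
  qed
  have "(cmod (a * z + b))\<^sup>2 / 2 \<le> M / 2 + ((cmod z)\<^sup>2 / 2 - c * (cmod z)\<^sup>2)" for z
    using le[of z] by (simp add: field_simps)
  then have "exp ((cmod (a * z + b))\<^sup>2 / 2) \<le> exp (M / 2) * exp ((cmod z)\<^sup>2 / 2 - c * (cmod z)\<^sup>2)" for z
    by (metis exp_add exp_le_cancel_iff)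
  moreover have "0 < c" using \<eta> by (simp add: c_def)
  ultimately show ?thesis using that[of c "exp (M / 2)"] by simp
qed

lemma fock_density_le_gaussian:
  assumes q: "0 < q" and N: "0 \<le> N"
    and g: "cmod (g z) \<le> N * exp ((cmod z)\<^sup>2 / 2 - c * (cmod z)\<^sup>2)"
  shows "fock_density q g z \<le> N powr q * exp (- (q * c * (cmod z)\<^sup>2))"
proof -
  have "cmod (g z) * exp (- ((cmod z)\<^sup>2 / 2)) \<le>
      N * exp ((cmod z)\<^sup>2 / 2 - c * (cmod z)\<^sup>2) * exp (- ((cmod z)\<^sup>2 / 2))"
    by (intro mult_right_mono g) auto
  also have "\<dots> = N * exp (- (c * (cmod z)\<^sup>2))"
    by (simp add: mult.assoc exp_add[symmetric])
  finally have "fock_density q g z \<le> (N * exp (- (c * (cmod z)\<^sup>2))) powr q"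
    unfolding fock_density_alt using q by (intro powr_mono2) auto
  also have "\<dots> = N powr q * exp (- (q * c * (cmod z)\<^sup>2))"
    by (subst powr_mult) (simp add: exp_powr_real mult_ac)
  finally show ?thesis .
qed

lemma fock_space_gaussian_growth:
  assumes q: "0 < q" and N: "0 \<le> N" and c: "0 < c" and hol: "g holomorphic_on UNIV"
    and g: "\<And>z. cmod (g z) \<le> N * exp ((cmod z)\<^sup>2 / 2 - c * (cmod z)\<^sup>2)"
  shows "g \<in> fock_space q"
proof -
  have "integrable lborel (\<lambda>z::complex. N powr q * exp (- (q * c * (cmod z)\<^sup>2)))"
    using q c by (intro integrable_mult_right integrable_gaussian) auto
  then have "integrable lborel (fock_density q g)"
    by (rule Bochner_Integration.integrable_bound)
      (use fock_density_le_gaussian[where g = g, OF q N g] fock_density_measurable[OF hol] in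
        \<open>auto simp: fock_density_nonneg\<close>)
  with hol show ?thesis by (simp add: fock_space_def)
qed

text \<open>Both branches of \<open>fock_dist\<close> are continuous functions of the integral that
  vanish at 0.\<close>

lemma fock_dist_tendsto_0:
  assumes q: "0 < q"
    and lim: "(\<lambda>n. \<integral>z. fock_density q (\<lambda>z. F n z - g z) z \<partial>lborel) \<longlonglongrightarrow> 0"
  shows "(\<lambda>n. fock_dist q (F n) g) \<longlonglongrightarrow> 0"
proof -
  have "(\<lambda>n. fock_norm q (\<lambda>z. F n z - g z)) \<longlonglongrightarrow> (q / (2 * pi) * 0) powr (1 / q)"
    unfolding fock_norm_def using q lim
    by (intro tendsto_powr' tendsto_mult tendsto_const) (auto simp: fock_density_nonneg)
  then have l: "(\<lambda>n. fock_norm q (\<lambda>z. F n z - g z)) \<longlonglongrightarrow> 0" using q by simp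
  then have "(\<lambda>n. fock_norm q (\<lambda>z. F n z - g z) powr q) \<longlonglongrightarrow> 0 powr q"
    using q by (intro tendsto_powr' tendsto_const) (auto simp: fock_norm_def)
  with l q show ?thesis
    by (cases "1 \<le> q") (simp_all add: fock_dist_def cong: if_cong)
qed

text \<open>The coefficients are arbitrary, so that \<open>1\<close> and \<open>0\<close> also give
  the single composition operators. Inside, \<open>grow\<close> starts from a pointwise bound
  instead of a norm bound, because it is applied to the limit function as well.\<close>

lemma fock_compact_op_affine:
  fixes a\<^sub>1 a\<^sub>2 b\<^sub>1 b\<^sub>2 c\<^sub>1 c\<^sub>2 :: complex
  assumes p: "0 < p" and q: "0 < q" and a: "cmod a\<^sub>1 < 1" "cmod a\<^sub>2 < 1"
  defines "\<phi>\<^sub>1 \<equiv> \<lambda>z. a\<^sub>1 * z + b\<^sub>1" and "\<phi>\<^sub>2 \<equiv> \<lambda>z. a\<^sub>2 * z + b\<^sub>2"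
  shows "fock_compact_op p q (\<lambda>f z. c\<^sub>1 * comp_op \<phi>\<^sub>1 f z + c\<^sub>2 * comp_op \<phi>\<^sub>2 f z)"
proof -
  define T where "T f z = c\<^sub>1 * comp_op \<phi>\<^sub>1 f z + c\<^sub>2 * comp_op \<phi>\<^sub>2 f z" for f z
  interpret Metric_space "fock_space q" "fock_dist q" by (rule Metric_space_fock[OF q])
  obtain d\<^sub>1 L\<^sub>1 where 1: "0 < d\<^sub>1" "0 < L\<^sub>1"
    "\<And>z. exp ((cmod (\<phi>\<^sub>1 z))\<^sup>2 / 2) \<le> L\<^sub>1 * exp ((cmod z)\<^sup>2 / 2 - d\<^sub>1 * (cmod z)\<^sup>2)"
    unfolding \<phi>\<^sub>1_def using affine_contraction_growth[OF a(1), of b\<^sub>1] by blast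
  obtain d\<^sub>2 L\<^sub>2 where 2: "0 < d\<^sub>2" "0 < L\<^sub>2"
    "\<And>z. exp ((cmod (\<phi>\<^sub>2 z))\<^sup>2 / 2) \<le> L\<^sub>2 * exp ((cmod z)\<^sup>2 / 2 - d\<^sub>2 * (cmod z)\<^sup>2)"
    unfolding \<phi>\<^sub>2_def using affine_contraction_growth[OF a(2), of b\<^sub>2] by blast
  obtain C where C: "0 < C"
    "\<And>f z I. f \<in> fock_space p \<Longrightarrow> (\<integral>z. fock_density p f z \<partial>lborel) \<le> I \<Longrightarrow>
        cmod (f z) \<le> (C * I) powr (1 / p) * exp ((cmod z)\<^sup>2 / 2)"
    using fock_growth[OF p] by blast
  define d where "d = min d\<^sub>1 d\<^sub>2"
  have d: "0 < d" using 1 2 by (simp add: d_def)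
  define L where "L = cmod c\<^sub>1 * L\<^sub>1 + cmod c\<^sub>2 * L\<^sub>2"
  have L: "0 \<le> L" using 1 2 by (auto simp: L_def intro!: add_nonneg_nonneg mult_nonneg_nonneg)
  have grow: "cmod (T f z) \<le> K * L * exp ((cmod z)\<^sup>2 / 2 - d * (cmod z)\<^sup>2)"
    if f: "\<And>z. cmod (f z) \<le> K * exp ((cmod z)\<^sup>2 / 2)" and K: "0 \<le> K" for f z K
  proof -
    have "cmod (f (\<phi>\<^sub>1 z)) \<le> K * (L\<^sub>1 * exp ((cmod z)\<^sup>2 / 2 - d * (cmod z)\<^sup>2))"
    proof -
      have "exp ((cmod (\<phi>\<^sub>1 z))\<^sup>2 / 2) \<le> L\<^sub>1 * exp ((cmod z)\<^sup>2 / 2 - d * (cmod z)\<^sup>2)"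
        by (rule order_trans[OF 1(3)]) (use 1(2) in \<open>auto simp: d_def intro!: mult_right_mono\<close>)
      then show ?thesis using f[of "\<phi>\<^sub>1 z"] K by (meson mult_left_mono order_trans)
    qed
    moreover have "cmod (f (\<phi>\<^sub>2 z)) \<le> K * (L\<^sub>2 * exp ((cmod z)\<^sup>2 / 2 - d * (cmod z)\<^sup>2))"
    proof -
      have "exp ((cmod (\<phi>\<^sub>2 z))\<^sup>2 / 2) \<le> L\<^sub>2 * exp ((cmod z)\<^sup>2 / 2 - d * (cmod z)\<^sup>2)"
        by (rule order_trans[OF 2(3)]) (use 2(2) in \<open>auto simp: d_def intro!: mult_right_mono\<close>)
      then show ?thesis using f[of "\<phi>\<^sub>2 z"] K by (meson mult_left_mono order_trans)
    qed
    ultimately have "cmod c\<^sub>1 * cmod (f (\<phi>\<^sub>1 z)) + cmod c\<^sub>2 * cmod (f (\<phi>\<^sub>2 z))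
        \<le> cmod c\<^sub>1 * (K * (L\<^sub>1 * exp ((cmod z)\<^sup>2 / 2 - d * (cmod z)\<^sup>2)))
          + cmod c\<^sub>2 * (K * (L\<^sub>2 * exp ((cmod z)\<^sup>2 / 2 - d * (cmod z)\<^sup>2)))"
      by (intro add_mono mult_left_mono) auto
    also have "\<dots> = K * L * exp ((cmod z)\<^sup>2 / 2 - d * (cmod z)\<^sup>2)"
      by (simp add: L_def algebra_simps)
    finally show ?thesis
      unfolding T_def comp_op_def comp_def by (metis norm_mult norm_triangle_le)
  qed
  have hol: "T f holomorphic_on UNIV" if "f holomorphic_on UNIV" for f
  proof -
    have "(\<lambda>z. f (\<phi>\<^sub>1 z)) holomorphic_on UNIV" "(\<lambda>z. f (\<phi>\<^sub>2 z)) holomorphic_on UNIV"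
      unfolding \<phi>\<^sub>1_def \<phi>\<^sub>2_def
      by (rule holomorphic_on_compose_gen[OF _ that, unfolded comp_def]; intro holomorphic_intros subset_UNIV)+
    then show ?thesis
      unfolding T_def[abs_def] comp_op_def comp_def by (intro holomorphic_intros)
  qed
  have maps: "T f \<in> fock_space q"
    if f: "\<And>z. cmod (f z) \<le> K * exp ((cmod z)\<^sup>2 / 2)" and K: "0 \<le> K"
      and "f holomorphic_on UNIV" for f K
    using fock_space_gaussian_growth[OF q _ d hol[OF that(3)] grow[OF f K]] K L by simp
  have sub: "T ` fock_space p \<subseteq> fock_space q"
  proof
    fix g assume "g \<in> T ` fock_space p"
    then obtain f where f: "f \<in> fock_space p" "g = T f" by auto
    show "g \<in> fock_space q"
      unfolding f(2) by (rule maps[OF C(2)[OF f(1) order_refl]]) (use f in \<open>auto simp: fock_space_def\<close>)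
  qed
  define K where "K = (C * (2 * pi / p)) powr (1 / p)"
  have K: "0 \<le> K" by (simp add: K_def)
  have ball: "cmod (f z) \<le> K * exp ((cmod z)\<^sup>2 / 2)" if f: "f \<in> fock_unit_ball p" for f z
    unfolding K_def
  proof (rule C(2))
    show "f \<in> fock_space p" using f by (simp add: fock_unit_ball_def)
    have "fock_norm p f powr p \<le> 1"
      using f p powr_mono2[of p "fock_norm p f" 1]
      by (simp add: fock_unit_ball_def fock_norm_def)
    then show "(\<integral>z. fock_density p f z \<partial>lborel) \<le> 2 * pi / p"
      unfolding fock_norm_powr[OF p] using p by (simp add: field_simps)
  qed
  have "compactin mtopology (mtopology closure_of (T ` fock_unit_ball p))"
    unfolding compact_closure_of_eq_Bolzano_Weierstrass
  proof (intro allI impI)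
    fix S assume "infinite S \<and> S \<subseteq> T ` fock_unit_ball p \<and> S \<subseteq> fock_space q"
    then have S: "infinite S" "S \<subseteq> T ` fock_unit_ball p" "S \<subseteq> fock_space q" by auto
    obtain \<sigma> :: "nat \<Rightarrow> complex \<Rightarrow> complex" where \<sigma>: "inj \<sigma>" "range \<sigma> \<subseteq> S"
      using infinite_countable_subset[OF S(1)] by blast
    have "\<forall>n. \<exists>f. f \<in> fock_unit_ball p \<and> \<sigma> n = T f" using \<sigma>(2) S(2) by blast
    then obtain F where F: "\<And>n. F n \<in> fock_unit_ball p" "\<And>n. \<sigma> n = T (F n)" by metis
    obtain g r where g: "g holomorphic_on UNIV" and r: "strict_mono (r :: nat \<Rightarrow> nat)"
      and lim: "\<And>z. (\<lambda>n. F (r n) z) \<longlonglongrightarrow> g z"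
    proof (rule Montel[of UNIV "fock_unit_ball p" F])
      show "h holomorphic_on UNIV" if "h \<in> fock_unit_ball p" for h
        using that by (simp add: fock_unit_ball_def fock_space_def)
      show "\<exists>B. \<forall>h\<in>fock_unit_ball p. \<forall>z\<in>X. cmod (h z) \<le> B" if X: "compact X" for X
      proof -
        have "bounded ((\<lambda>z. K * exp ((cmod z)\<^sup>2 / 2)) ` X)"
          using X by (intro compact_imp_bounded compact_continuous_image continuous_intros) auto
        then obtain B where "\<And>z. z \<in> X \<Longrightarrow> K * exp ((cmod z)\<^sup>2 / 2) \<le> B"
          by (auto simp: bounded_iff) (smt (verit))
        then show ?thesis using ball by (meson order_trans)
      qed
    qed (use F in auto)
    \<comment> \<open>The growth bound passes to the pointwise limit, and this bound alone puts
      \<open>T g\<close> into the target space.\<close>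
    have gb: "cmod (g z) \<le> K * exp ((cmod z)\<^sup>2 / 2)" for z
      using ball[OF F(1)] by (intro Lim_bounded[OF tendsto_norm[OF lim]]) auto
    have Tg: "T g \<in> fock_space q" by (rule maps[OF gb K g])
    define w where "w z = (K * L + K * L) powr q * exp (- (q * d * (cmod z)\<^sup>2))" for z :: complex
    have "(\<lambda>n. \<integral>z. fock_density q (\<lambda>z. \<sigma> (r n) z - T g z) z \<partial>lborel) \<longlonglongrightarrow> integral\<^sup>L lborel (\<lambda>z::complex. 0 :: real)"
    proof (rule integral_dominated_convergence[where w = w])
      show "integrable lborel w"
        unfolding w_def using q d by (intro integrable_mult_right integrable_gaussian) auto
      have hd: "(\<lambda>z. \<sigma> (r n) z - T g z) holomorphic_on UNIV" for n
        using F(1)[of "r n"] g unfolding F(2)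
        by (intro holomorphic_on_diff hol) (auto simp: fock_unit_ball_def fock_space_def)
      show "fock_density q (\<lambda>z. \<sigma> (r n) z - T g z) \<in> borel_measurable lborel" for n
        using fock_density_measurable[OF hd] by simp
      show "AE z in lborel. (\<lambda>n. fock_density q (\<lambda>z. \<sigma> (r n) z - T g z) z) \<longlonglongrightarrow> 0"
      proof (intro AE_I2)
        fix z
        have "(\<lambda>n. T (F (r n)) z - T g z) \<longlonglongrightarrow> T g z - T g z"
          unfolding T_def comp_op_def comp_def by (intro tendsto_intros lim)
        then have "(\<lambda>n. cmod (\<sigma> (r n) z - T g z)) \<longlonglongrightarrow> 0"
          unfolding F(2) using tendsto_norm_zero by force
        then have "(\<lambda>n. cmod (\<sigma> (r n) z - T g z) powr q * exp (- (q * (cmod z)\<^sup>2 / 2)))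
            \<longlonglongrightarrow> 0 powr q * exp (- (q * (cmod z)\<^sup>2 / 2))"
          using q by (intro tendsto_mult tendsto_powr' tendsto_const) auto
        then show "(\<lambda>n. fock_density q (\<lambda>z. \<sigma> (r n) z - T g z) z) \<longlonglongrightarrow> 0"
          using q by (simp add: fock_density_def)
      qed
      show "AE z in lborel. norm (fock_density q (\<lambda>z. \<sigma> (r n) z - T g z) z) \<le> w z" for n
      proof (intro AE_I2)
        fix z
        have "cmod (\<sigma> (r n) z - T g z) \<le> K * L * exp ((cmod z)\<^sup>2 / 2 - d * (cmod z)\<^sup>2)
            + K * L * exp ((cmod z)\<^sup>2 / 2 - d * (cmod z)\<^sup>2)"
          unfolding F(2)
          by (rule order_trans[OF norm_triangle_ineq4 add_mono[OF grow[OF ball[OF F(1)] K] grow[OF gb K]]])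
        then have "fock_density q (\<lambda>z. \<sigma> (r n) z - T g z) z \<le> w z"
          unfolding w_def using q K L
          by (intro fock_density_le_gaussian) (auto simp: distrib_right)
        then show "norm (fock_density q (\<lambda>z. \<sigma> (r n) z - T g z) z) \<le> w z"
          by (simp add: fock_density_nonneg)
      qed
    qed auto
    then have "(\<lambda>n. fock_dist q (\<sigma> (r n)) (T g)) \<longlonglongrightarrow> 0"
      by (intro fock_dist_tendsto_0[OF q]) simp
    note conv = this
    have "T g \<in> mtopology derived_set_of S"
      unfolding metric_derived_set_of
    proof (intro CollectI conjI allI impI Tg)
      fix \<epsilon> :: real assume "0 < \<epsilon>"
      then obtain N where N: "\<And>n. N \<le> n \<Longrightarrow> fock_dist q (\<sigma> (r n)) (T g) < \<epsilon>"
        using order_tendstoD(2)[OF conv] by (auto simp: eventually_sequentially)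
      \<comment> \<open>By injectivity of \<open>\<sigma>\<close>, two consecutive terms cannot both
        equal \<open>T g\<close>; so some term close to \<open>T g\<close> differs from it, as a
        limit point demands.\<close>
      have "r N \<noteq> r (Suc N)" using r by (simp add: strict_mono_eq)
      then have "\<sigma> (r N) \<noteq> \<sigma> (r (Suc N))" using \<sigma>(1) by (simp add: inj_eq)
      then obtain n where "N \<le> n" "\<sigma> (r n) \<noteq> T g" by (metis le_Suc_eq order_refl)
      with N[of n] show "\<exists>y\<in>S. y \<noteq> T g \<and> y \<in> mball (T g) \<epsilon>"
        using \<sigma>(2) S(3) Tg by (intro bexI[of _ "\<sigma> (r n)"]) (auto simp: commute)
    qed
    then show "mtopology derived_set_of S \<noteq> {}" by auto
  qed
  with sub show ?thesis unfolding fock_compact_op_def T_def[abs_def] by simp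
qed

subsection \<open>Boundedness as a norm estimate\<close>

text \<open>The operator norm inequality raised to the power \<open>q\<close> and freed of the
  normalising constants, which avoids roots and the two branches of
  \<open>fock_dist\<close>.\<close>

definition fock_estimate ::
  "real \<Rightarrow> real \<Rightarrow> ((complex \<Rightarrow> complex) \<Rightarrow> complex \<Rightarrow> complex) \<Rightarrow> bool" where
  "fock_estimate p q T \<longleftrightarrow> T ` fock_space p \<subseteq> fock_space q \<and>
     (\<exists>B\<ge>0. \<forall>f\<in>fock_space p. (\<integral>z. fock_density q (T f) z \<partial>lborel)
        \<le> B * (\<integral>z. fock_density p f z \<partial>lborel) powr (q / p))"

lemma fock_density_cmult: "fock_density q (\<lambda>z. c * g z) z = cmod c powr q * fock_density q g z"
  by (simp add: fock_density_def norm_mult powr_mult)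

lemma integral_fock_density_nonneg: "0 \<le> (\<integral>z. fock_density q g z \<partial>lborel)"
  by (simp add: fock_density_nonneg)

lemma integral_fock_density_cmult:
  "(\<integral>z. fock_density q (\<lambda>z. c * g z) z \<partial>lborel) = cmod c powr q * (\<integral>z. fock_density q g z \<partial>lborel)"
  by (simp add: fock_density_cmult)

lemma fock_space_cmult: "g \<in> fock_space q \<Longrightarrow> (\<lambda>z. c * g z) \<in> fock_space q"
  by (auto simp: fock_space_def fock_density_cmult[abs_def] intro!: holomorphic_intros)

lemma fock_space_zero: "(\<lambda>z. 0) \<in> fock_space p"
  by (simp add: fock_space_def fock_density_def[abs_def])

text \<open>The modulus of a sum is at most twice the larger modulus, which serves
  \<open>q < 1\<close> and \<open>q \<ge> 1\<close> alike.\<close>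

lemma fock_density_add_le:
  assumes q: "0 < q"
  shows "fock_density q (\<lambda>z. f z + g z) z \<le> 2 powr q * (fock_density q f z + fock_density q g z)"
proof -
  define E where "E = exp (- ((cmod z)\<^sup>2 / 2))"
  define m where "m = max (cmod (f z) * E) (cmod (g z) * E)"
  have E: "0 < E" by (simp add: E_def)
  have m0: "0 \<le> m" using E by (simp add: m_def le_max_iff_disj)
  have "cmod (f z + g z) * E \<le> (cmod (f z) + cmod (g z)) * E"
    using E by (intro mult_right_mono norm_triangle_ineq) auto
  also have "\<dots> \<le> 2 * m" by (simp add: m_def distrib_right)
  finally have "fock_density q (\<lambda>z. f z + g z) z \<le> (2 * m) powr q"
    unfolding fock_density_alt using q E by (intro powr_mono2) (auto simp: E_def)
  also have "\<dots> = 2 powr q * m powr q" using m0 by (intro powr_mult)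
  also have "m powr q \<le> fock_density q f z + fock_density q g z"
    by (cases "cmod (f z) * E \<le> cmod (g z) * E")
      (auto simp: m_def max_def fock_density_alt E_def)
  finally show ?thesis by simp
qed

lemma integral_fock_density_add_le:
  assumes q: "0 < q" and f: "f \<in> fock_space q" and g: "g \<in> fock_space q"
  shows "(\<integral>z. fock_density q (\<lambda>z. f z + g z) z \<partial>lborel) \<le>
    2 powr q * ((\<integral>z. fock_density q f z \<partial>lborel) + (\<integral>z. fock_density q g z \<partial>lborel))"
proof -
  have "(\<integral>z. fock_density q (\<lambda>z. f z + g z) z \<partial>lborel) \<le>
      (\<integral>z. 2 powr q * (fock_density q f z + fock_density q g z) \<partial>lborel)"
    using f g fock_space_add[OF q f g] fock_density_add_le[OF q, of f g]
    by (intro integral_mono) (auto simp: fock_space_def)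
  also have "\<dots> = 2 powr q * ((\<integral>z. fock_density q f z \<partial>lborel) + (\<integral>z. fock_density q g z \<partial>lborel))"
    using f g by (subst integral_mult_right_zero, subst Bochner_Integration.integral_add)
      (auto simp: fock_space_def)
  finally show ?thesis .
qed

text \<open>Allows a bounded operator to be subtracted from the combination, isolating a single
  composition operator, and gives the estimate for the combination from those for its parts.\<close>

lemma fock_estimate_lincomb:
  assumes q: "0 < q" and S: "fock_estimate p q S" and T: "fock_estimate p q T"
  shows "fock_estimate p q (\<lambda>f z. c * S f z + d * T f z)"
proof -
  obtain B where B: "0 \<le> B" "\<And>f. f \<in> fock_space p \<Longrightarrow> (\<integral>z. fock_density q (S f) z \<partial>lborel)
        \<le> B * (\<integral>z. fock_density p f z \<partial>lborel) powr (q / p)"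
    using S by (auto simp: fock_estimate_def)
  obtain D where D: "0 \<le> D" "\<And>f. f \<in> fock_space p \<Longrightarrow> (\<integral>z. fock_density q (T f) z \<partial>lborel)
        \<le> D * (\<integral>z. fock_density p f z \<partial>lborel) powr (q / p)"
    using T by (auto simp: fock_estimate_def)
  have mem: "(\<lambda>z. c * S f z) \<in> fock_space q" "(\<lambda>z. d * T f z) \<in> fock_space q" if "f \<in> fock_space p" for f
    using S T that by (auto simp: fock_estimate_def intro!: fock_space_cmult)
  define M where "M = 2 powr q * (cmod c powr q * B + cmod d powr q * D)"
  have "(\<integral>z. fock_density q (\<lambda>z. c * S f z + d * T f z) z \<partial>lborel)
        \<le> M * (\<integral>z. fock_density p f z \<partial>lborel) powr (q / p)" if f: "f \<in> fock_space p" for f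
  proof -
    let ?I = "(\<integral>z. fock_density p f z \<partial>lborel) powr (q / p)"
    have "(\<integral>z. fock_density q (\<lambda>z. c * S f z + d * T f z) z \<partial>lborel) \<le>
      2 powr q * (cmod c powr q * (\<integral>z. fock_density q (S f) z \<partial>lborel)
        + cmod d powr q * (\<integral>z. fock_density q (T f) z \<partial>lborel))"
      using integral_fock_density_add_le[OF q mem[OF f]] by (simp add: integral_fock_density_cmult)
    also have "\<dots> \<le> 2 powr q * (cmod c powr q * (B * ?I) + cmod d powr q * (D * ?I))"
      using B(2)[OF f] D(2)[OF f] by (intro mult_left_mono add_mono) auto
    also have "\<dots> = M * ?I" by (simp add: M_def algebra_simps)
    finally show ?thesis .
  qed
  moreover have "0 \<le> M" using B(1) D(1) by (simp add: M_def)
  moreover have "(\<lambda>f z. c * S f z + d * T f z) ` fock_space p \<subseteq> fock_space q"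
    using fock_space_add[OF q mem] by auto
  ultimately show ?thesis unfolding fock_estimate_def by blast
qed

text \<open>Homogeneity scales any nonzero \<open>f\<close> to norm 1, which turns a bound on the
  image of the unit ball into an estimate for all \<open>f\<close>. It also makes \<open>T\<close>
  fix the zero function, the reference point from which the image is measured.\<close>

lemma fock_bounded_op_iff_estimate:
  assumes p: "0 < p" and q: "0 < q"
    and hom: "\<And>c f. T (\<lambda>z. c * f z) = (\<lambda>z. c * T f z)"
  shows "fock_bounded_op p q T \<longleftrightarrow> fock_estimate p q T"
proof -
  interpret Metric_space "fock_space q" "fock_dist q" by (rule Metric_space_fock[OF q])
  have T0: "T (\<lambda>z. 0) = (\<lambda>z. 0)" using hom[of 0 "\<lambda>z. 0"] by simp
  show ?thesis
  proof
    assume bd: "fock_bounded_op p q T"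
    then have "\<exists>R. \<forall>g\<in>T ` fock_unit_ball p. \<forall>h\<in>T ` fock_unit_ball p. fock_dist q g h \<le> R"
      unfolding fock_bounded_op_def mbounded_alt by (elim conjE)
    then obtain R where R: "\<And>g h. g \<in> T ` fock_unit_ball p \<Longrightarrow> h \<in> T ` fock_unit_ball p \<Longrightarrow> fock_dist q g h \<le> R"
      by auto
    have sub: "T ` fock_space p \<subseteq> fock_space q" using bd by (simp add: fock_bounded_op_def)
    have zero: "(\<lambda>z. 0) \<in> fock_unit_ball p"
      using p by (simp add: fock_unit_ball_def fock_space_zero fock_norm_def fock_density_def)
    \<comment> \<open>The metric bounds the norm when \<open>q \<ge> 1\<close> and its
      \<open>q\<close>-th power otherwise; \<open>R'\<close> bounds the \<open>q\<close>-th power in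
      both cases.\<close>
    define R' where "R' = max R (R powr q)"
    have unit: "(\<integral>z. fock_density q (T f) z \<partial>lborel) \<le> 2 * pi / q * R'" if f: "f \<in> fock_unit_ball p" for f
    proof -
      have "fock_dist q (T f) (T (\<lambda>z. 0)) \<le> R" using f zero by (intro R) auto
      then have d: "fock_dist q (T f) (\<lambda>z. 0) \<le> R" by (simp add: T0)
      have "fock_norm q (T f) powr q \<le> R'"
      proof (cases "1 \<le> q")
        case True
        then have "fock_norm q (T f) powr q \<le> R powr q"
          using d q by (intro powr_mono2) (auto simp: fock_dist_def fock_norm_def)
        then show ?thesis by (simp add: R'_def)
      qed (use d in \<open>simp add: fock_dist_def R'_def\<close>)
      then show ?thesis using q by (simp add: fock_norm_powr[OF q] field_simps)
    qed
    have R'0: "0 \<le> R'" by (simp add: R'_def le_max_iff_disj)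
    define B where "B = 2 * pi / q * R' * (p / (2 * pi)) powr (q / p)"
    have "(\<integral>z. fock_density q (T f) z \<partial>lborel) \<le> B * (\<integral>z. fock_density p f z \<partial>lborel) powr (q / p)"
      if f: "f \<in> fock_space p" for f
    proof (cases "fock_norm p f = 0")
      case True
      then have "f = (\<lambda>z. 0)" using fock_norm_eq_0_iff[OF p f] by auto
      then show ?thesis using q by (simp add: T0 fock_density_def)
    next
      case False
      define N where "N = fock_norm p f"
      have N: "0 < N" using False by (simp add: N_def fock_norm_def)
      define k where "k = complex_of_real (1 / N)"
      have ck: "cmod k = 1 / N" using N by (simp add: k_def norm_divide)
      have "fock_norm p (\<lambda>z. k * f z) powr p = (1 / N) powr p * fock_norm p f powr p"
        unfolding fock_norm_powr[OF p] integral_fock_density_cmult ck by simp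
      also have "\<dots> = 1" using N by (simp add: N_def powr_mult[symmetric])
      finally have "(fock_norm p (\<lambda>z. k * f z) powr p) powr (1 / p) = 1" by simp
      moreover have nn: "0 \<le> fock_norm p (\<lambda>z. k * f z)" by (simp add: fock_norm_def)
      ultimately have "fock_norm p (\<lambda>z. k * f z) = 1"
        using p nn by (simp add: powr_powr)
      then have "(\<lambda>z. k * f z) \<in> fock_unit_ball p"
        using fock_space_cmult[OF f] by (simp add: fock_unit_ball_def)
      from unit[OF this] have "(1 / N) powr q * (\<integral>z. fock_density q (T f) z \<partial>lborel) \<le> 2 * pi / q * R'"
        unfolding hom integral_fock_density_cmult ck .
      then have "(\<integral>z. fock_density q (T f) z \<partial>lborel) \<le> 2 * pi / q * R' * N powr q"
        using N by (simp add: powr_divide divide_le_eq)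
      also have "N powr q = (p / (2 * pi) * (\<integral>z. fock_density p f z \<partial>lborel)) powr (q / p)"
        by (simp add: N_def fock_norm_def powr_powr)
      also have "\<dots> = (p / (2 * pi)) powr (q / p) * (\<integral>z. fock_density p f z \<partial>lborel) powr (q / p)"
        using p by (intro powr_mult)
      finally show ?thesis by (simp add: B_def mult.assoc)
    qed
    moreover have "0 \<le> B" using R'0 q by (simp add: B_def)
    ultimately show "fock_estimate p q T" using sub unfolding fock_estimate_def by blast
  next
    assume "fock_estimate p q T"
    then obtain B where sub: "T ` fock_space p \<subseteq> fock_space q" and B: "0 \<le> B"
      "\<And>f. f \<in> fock_space p \<Longrightarrow> (\<integral>z. fock_density q (T f) z \<partial>lborel)
          \<le> B * (\<integral>z. fock_density p f z \<partial>lborel) powr (q / p)"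
      by (auto simp: fock_estimate_def)
    define N where "N = (q / (2 * pi) * (B * (2 * pi / p) powr (q / p))) powr (1 / q)"
    have "fock_dist q (\<lambda>z. 0) g \<le> max N (N powr q)" if g: "g \<in> T ` fock_unit_ball p" for g
    proof -
      obtain f where f: "f \<in> fock_space p" "fock_norm p f \<le> 1" "g = T f"
        using g by (auto simp: fock_unit_ball_def)
      have "fock_norm p f powr p \<le> 1"
        using f p powr_mono2[of p "fock_norm p f" 1] by (simp add: fock_norm_def)
      then have "(\<integral>z. fock_density p f z \<partial>lborel) \<le> 2 * pi / p"
        unfolding fock_norm_powr[OF p] using p by (simp add: field_simps)
      then have "B * (\<integral>z. fock_density p f z \<partial>lborel) powr (q / p) \<le> B * (2 * pi / p) powr (q / p)"
        using p q B(1) by (intro mult_left_mono powr_mono2) (auto simp: integral_fock_density_nonneg)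
      with B(2)[OF f(1)] have "(\<integral>z. fock_density q g z \<partial>lborel) \<le> B * (2 * pi / p) powr (q / p)"
        unfolding f(3) by linarith
      then have N: "fock_norm q g \<le> N"
        unfolding fock_norm_def N_def using q
        by (intro powr_mono2 mult_left_mono) (auto simp: integral_fock_density_nonneg)
      have "fock_dist q (\<lambda>z. 0) g = fock_dist q g (\<lambda>z. 0)" by (rule commute)
      also have "\<dots> = (if q \<ge> 1 then fock_norm q g else fock_norm q g powr q)"
        by (simp add: fock_dist_def)
      also have "\<dots> \<le> max N (N powr q)"
        using N q powr_mono2[of q "fock_norm q g" N] by (auto simp: fock_norm_def le_max_iff_disj)
      finally show ?thesis .
    qed
    moreover have "T ` fock_unit_ball p \<subseteq> fock_space q"
      using sub by (auto simp: fock_unit_ball_def)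
    ultimately have "T ` fock_unit_ball p \<subseteq> mcball (\<lambda>z. 0) (max N (N powr q))"
      using fock_space_zero by auto
    then show "fock_bounded_op p q T"
      using sub unfolding fock_bounded_op_def mbounded_def by blast
  qed
qed

lemma fock_compact_op_imp_bounded:
  assumes q: "0 < q" and T: "fock_compact_op p q T"
  shows "fock_bounded_op p q T"
proof -
  interpret Metric_space "fock_space q" "fock_dist q" by (rule Metric_space_fock[OF q])
  have "T ` fock_unit_ball p \<subseteq> fock_space q"
    using T by (auto simp: fock_compact_op_def fock_unit_ball_def)
  with T show ?thesis
    unfolding fock_compact_op_def fock_bounded_op_def
    using compactin_imp_mbounded mbounded_closure_of_eq by blast
qed

lemma fock_estimate_affine:
  assumes "0 < p" "0 < q" "cmod a < 1"
  shows "fock_estimate p q (comp_op (\<lambda>z. a * z + b))"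
proof -
  have "fock_compact_op p q (\<lambda>f z. 1 * comp_op (\<lambda>z. a * z + b) f z + 0 * comp_op (\<lambda>z. a * z + b) f z)"
    by (rule fock_compact_op_affine) (use assms in auto)
  then have "fock_compact_op p q (comp_op (\<lambda>z. a * z + b))" by simp
  then have "fock_bounded_op p q (comp_op (\<lambda>z. a * z + b))"
    by (rule fock_compact_op_imp_bounded[OF assms(2)])
  then show ?thesis
    using assms by (subst (asm) fock_bounded_op_iff_estimate) (auto simp: comp_op_def comp_def)
qed

text \<open>Completing the square shows that the density is
  \<open>exp (p * (cmod w)\<^sup>2 / 2)\<close> times a Gaussian translated to \<open>w\<close>. By
  translation invariance the integral \<open>G\<close> of that Gaussian is the same for every
  \<open>w\<close>.\<close>

lemma fock_kernel:
  fixes p :: real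
  assumes p: "0 < p"
  obtains G where "0 \<le> G"
    "\<And>w. (\<lambda>z. exp (z * cnj w)) \<in> fock_space p"
    "\<And>w. (\<integral>z. fock_density p (\<lambda>z. exp (z * cnj w)) z \<partial>lborel) = G * exp (p * (cmod w)\<^sup>2 / 2)"
proof -
  define \<gamma> where "\<gamma> z = exp (- (p / 2 * (cmod z)\<^sup>2))" for z :: complex
  have [measurable]: "\<gamma> \<in> borel_measurable borel" unfolding \<gamma>_def by measurable
  have int: "integrable lborel \<gamma>" unfolding \<gamma>_def using p by (intro integrable_gaussian) simp
  have transl: "distr lborel borel ((+) (- w)) = (lborel :: complex measure)" for w
    by (rule lborel_distr_plus)
  have intw: "integrable lborel (\<lambda>z. \<gamma> (- w + z))" for w
    using int by (subst (asm) transl[of w, symmetric], subst (asm) integrable_distr_eq) auto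
  have eqw: "(\<integral>z. \<gamma> (- w + z) \<partial>lborel) = (\<integral>z. \<gamma> z \<partial>lborel)" for w
    by (subst (2) transl[of w, symmetric], subst integral_distr) auto
  have dens: "fock_density p (\<lambda>z. exp (z * cnj w)) = (\<lambda>z. exp (p * (cmod w)\<^sup>2 / 2) * \<gamma> (- w + z))" for w
  proof
    fix z
    define R where "R = Re (z * cnj w)"
    have sq: "(cmod (- w + z))\<^sup>2 = (cmod w)\<^sup>2 + (cmod z)\<^sup>2 - 2 * R"
      unfolding cmod_power2 R_def by (simp add: power2_eq_square algebra_simps)
    have "p * Re (z * cnj w) + - (p * (cmod z)\<^sup>2 / 2) = p * (cmod w)\<^sup>2 / 2 + - (p / 2 * (cmod (- w + z))\<^sup>2)"
      unfolding sq R_def[symmetric] by (simp add: field_simps)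
    then show "fock_density p (\<lambda>z. exp (z * cnj w)) z = exp (p * (cmod w)\<^sup>2 / 2) * \<gamma> (- w + z)"
      unfolding fock_density_def \<gamma>_def norm_exp_eq_Re exp_powr_real exp_add[symmetric]
      by (simp add: mult.commute)
  qed
  show ?thesis
  proof (rule that[of "integral\<^sup>L lborel \<gamma>"])
    show "0 \<le> integral\<^sup>L lborel \<gamma>" by (simp add: \<gamma>_def)
    show "(\<lambda>z. exp (z * cnj w)) \<in> fock_space p" for w
    proof -
      have "(\<lambda>z. exp (z * cnj w)) holomorphic_on UNIV" by (intro holomorphic_intros)
      then show ?thesis by (simp only: fock_space_def mem_Collect_eq dens) (simp add: intw[simplified])
    qed
    show "(\<integral>z. fock_density p (\<lambda>z. exp (z * cnj w)) z \<partial>lborel) = integral\<^sup>L lborel \<gamma> * exp (p * (cmod w)\<^sup>2 / 2)" for w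
      unfolding dens by (simp only: integral_mult_right_zero eqw) (rule mult.commute)
  qed
qed

subsection \<open>Symbols of bounded operators\<close>

text \<open>
  Only two test points matter: \<open>w = \<alpha>\<close>, and \<open>w = \<alpha> + u\<close> with \<open>(\<beta> - \<alpha>) * cnj u = min 1 \<bar>\<beta> - \<alpha>\<bar>\<close>.
  The two exponentials cannot nearly cancel at both.
\<close>

lemma kernel_pair_separation:
  fixes c\<^sub>1 c\<^sub>2 \<alpha> \<beta> :: complex
  assumes R: "\<And>w. cmod (c\<^sub>1 * exp (\<alpha> * cnj w) + c\<^sub>2 * exp (\<beta> * cnj w)) \<le> R * exp ((cmod w)\<^sup>2 / 2)"
  shows "cmod c\<^sub>1 * min 1 (cmod (\<alpha> - \<beta>)) * exp ((cmod \<alpha>)\<^sup>2 / 2) \<le> (exp 1 + 1) * exp (1 / 2) * R"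
proof -
  have R0: "0 \<le> R" using order_trans[OF norm_ge_zero R[of 0]] by simp
  show ?thesis
  proof (cases "\<alpha> = \<beta>")
    case True
    then show ?thesis using R0 by (simp add: add_nonneg_nonneg)
  next
    case False
    define \<delta> where "\<delta> = \<beta> - \<alpha>"
    have \<delta>: "\<delta> \<noteq> 0" using False by (simp add: \<delta>_def)
    define t where "t = min 1 (cmod \<delta>)"
    have t: "0 < t" "t \<le> 1" "t \<le> cmod \<delta>" using \<delta> by (auto simp: t_def)
    \<comment> \<open>\<open>X u\<close> is the combination at \<open>w = \<alpha> + u\<close>
      divided by \<open>exp (\<alpha> * cnj w)\<close>. For \<open>cmod u \<le> 1\<close> the real
      part of \<open>\<alpha> * cnj w\<close> is within \<open>1 / 2\<close> of half the sum of the
      squared moduli of \<open>\<alpha>\<close> and \<open>w\<close>, so the division costs only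
      \<open>exp (1 / 2)\<close>.\<close>
    define X where "X u = c\<^sub>1 + c\<^sub>2 * exp (\<delta> * cnj (\<alpha> + u))" for u
    have X: "cmod (X u) * exp ((cmod \<alpha>)\<^sup>2 / 2) \<le> exp (1 / 2) * R" if u: "cmod u \<le> 1" for u
    proof -
      define w where "w = \<alpha> + u"
      define r where "r = Re (\<alpha> * cnj w)"
      have u2: "(cmod u)\<^sup>2 \<le> 1" using u by (simp add: abs_square_le_1)
      have "2 * r = (cmod \<alpha>)\<^sup>2 + (cmod w)\<^sup>2 - (cmod u)\<^sup>2"
        unfolding cmod_power2 r_def w_def by (simp add: power2_eq_square algebra_simps)
      then have r: "(cmod \<alpha>)\<^sup>2 / 2 + (cmod w)\<^sup>2 / 2 \<le> r + 1 / 2" using u2 by simp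
      have "c\<^sub>1 * exp (\<alpha> * cnj w) + c\<^sub>2 * exp (\<beta> * cnj w) = exp (\<alpha> * cnj w) * X u"
      proof -
        have "\<beta> * cnj w = \<alpha> * cnj w + \<delta> * cnj w" by (simp add: \<delta>_def algebra_simps)
        then show ?thesis by (simp add: X_def w_def[symmetric] exp_add algebra_simps)
      qed
      then have "exp r * cmod (X u) \<le> R * exp ((cmod w)\<^sup>2 / 2)"
        using R[of w] by (simp add: norm_mult r_def)
      have "cmod (X u) * exp ((cmod \<alpha>)\<^sup>2 / 2) * exp ((cmod w)\<^sup>2 / 2)
          = cmod (X u) * exp ((cmod \<alpha>)\<^sup>2 / 2 + (cmod w)\<^sup>2 / 2)"
        by (simp add: exp_add)
      also have "\<dots> \<le> cmod (X u) * exp (r + 1 / 2)"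
        using r by (intro mult_left_mono) auto
      also have "\<dots> = exp (1 / 2) * (exp r * cmod (X u))"
        by (simp add: exp_add mult_ac)
      also have "\<dots> \<le> exp (1 / 2) * (R * exp ((cmod w)\<^sup>2 / 2))"
        by (intro mult_left_mono, fact) simp
      finally show ?thesis by (simp add: mult.assoc[symmetric])
    qed
    define u where "u = cnj (of_real t / \<delta>)"
    have "cmod u = t / cmod \<delta>" using t by (simp add: u_def norm_divide)
    then have u1: "cmod u \<le> 1" using t \<delta> by simp
    have "\<delta> * cnj (\<alpha> + u) = \<delta> * cnj \<alpha> + of_real t" using \<delta> by (simp add: u_def distrib_left)
    \<comment> \<open>By the choice of \<open>u\<close>, the term with \<open>c\<^sub>2\<close> has
      an additional factor \<open>exp t\<close> in \<open>X u\<close>. This difference therefore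
      eliminates \<open>c\<^sub>2\<close> and leaves \<open>c\<^sub>1\<close> times a factor of size
      at least \<open>t\<close>.\<close>
    then have "exp (of_real t) * X 0 - X u = c\<^sub>1 * (exp (of_real t) - 1)"
      by (simp add: X_def exp_add algebra_simps)
    then have "cmod c\<^sub>1 * cmod (exp (of_real t) - 1) \<le> cmod (exp (of_real t) * X 0) + cmod (X u)"
      by (metis norm_mult norm_triangle_ineq4)
    also have "exp (of_real t) - 1 = (of_real (exp t - 1) :: complex)"
      by (simp add: exp_of_real)
    also have "cmod (of_real (exp t - 1)) = exp t - 1"
      using t unfolding norm_of_real by simp
    also have "cmod (exp (of_real t) * X 0) = exp t * cmod (X 0)"
      by (simp add: norm_mult)
    finally have 1: "cmod c\<^sub>1 * (exp t - 1) \<le> exp t * cmod (X 0) + cmod (X u)" .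
    have "cmod c\<^sub>1 * t \<le> cmod c\<^sub>1 * (exp t - 1)"
      using exp_ge_add_one_self[of t] by (intro mult_left_mono) (linarith, simp)
    also note 1
    also have "exp t * cmod (X 0) + cmod (X u) \<le> exp 1 * cmod (X 0) + cmod (X u)"
      using t by (intro add_right_mono mult_right_mono) auto
    finally have "cmod c\<^sub>1 * t * exp ((cmod \<alpha>)\<^sup>2 / 2) \<le> (exp 1 * cmod (X 0) + cmod (X u)) * exp ((cmod \<alpha>)\<^sup>2 / 2)"
      by (intro mult_right_mono) auto
    also have "\<dots> = exp 1 * (cmod (X 0) * exp ((cmod \<alpha>)\<^sup>2 / 2)) + cmod (X u) * exp ((cmod \<alpha>)\<^sup>2 / 2)"
      by (simp add: distrib_right)
    also have "\<dots> \<le> exp 1 * (exp (1 / 2) * R) + exp (1 / 2) * R"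
      using X[of 0] X[OF u1] by (intro add_mono mult_left_mono) auto
    finally show ?thesis
      by (simp add: t_def \<delta>_def norm_minus_commute algebra_simps)
  qed
qed

text \<open>For fixed \<open>z\<close>, pointwise growth of the image of the kernel at
  \<open>w\<close> is the hypothesis of \<open>kernel_pair_separation\<close>, with the values of
  the symbols at \<open>z\<close> as \<open>\<alpha>\<close> and \<open>\<beta>\<close>. The
  exponents cancel: raising \<open>exp (p * (cmod w)\<^sup>2 / 2)\<close> to \<open>q / p\<close>
  and then to \<open>1 / q\<close> gives \<open>exp ((cmod w)\<^sup>2 / 2)\<close>.\<close>

lemma fock_estimate_separation:
  fixes \<phi>\<^sub>1 \<phi>\<^sub>2 :: "complex \<Rightarrow> complex"
  assumes p: "0 < p" and q: "0 < q" and c: "c\<^sub>1 \<noteq> 0"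
    and T: "fock_estimate p q (\<lambda>f z. c\<^sub>1 * comp_op \<phi>\<^sub>1 f z + c\<^sub>2 * comp_op \<phi>\<^sub>2 f z)"
  obtains C where "0 < C"
    "\<And>z. min 1 (cmod (\<phi>\<^sub>1 z - \<phi>\<^sub>2 z)) * exp ((cmod (\<phi>\<^sub>1 z))\<^sup>2 / 2) \<le> C * exp ((cmod z)\<^sup>2 / 2)"
proof -
  let ?T = "\<lambda>f z. c\<^sub>1 * comp_op \<phi>\<^sub>1 f z + c\<^sub>2 * comp_op \<phi>\<^sub>2 f z"
  obtain B where B: "0 \<le> B" "\<And>f. f \<in> fock_space p \<Longrightarrow> (\<integral>z. fock_density q (?T f) z \<partial>lborel)
        \<le> B * (\<integral>z. fock_density p f z \<partial>lborel) powr (q / p)"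
    and sub: "?T ` fock_space p \<subseteq> fock_space q"
    using T by (auto simp: fock_estimate_def)
  obtain G where G: "0 \<le> G" "\<And>w. (\<lambda>z. exp (z * cnj w)) \<in> fock_space p"
    "\<And>w. (\<integral>z. fock_density p (\<lambda>z. exp (z * cnj w)) z \<partial>lborel) = G * exp (p * (cmod w)\<^sup>2 / 2)"
    using fock_kernel[OF p] by blast
  obtain K where K: "0 < K"
    "\<And>f z I. f \<in> fock_space q \<Longrightarrow> (\<integral>z. fock_density q f z \<partial>lborel) \<le> I \<Longrightarrow>
        cmod (f z) \<le> (K * I) powr (1 / q) * exp ((cmod z)\<^sup>2 / 2)"
    using fock_growth[OF q] by blast
  define D where "D = (K * B * G powr (q / p)) powr (1 / q)"
  have bound: "cmod (c\<^sub>1 * exp (\<phi>\<^sub>1 z * cnj w) + c\<^sub>2 * exp (\<phi>\<^sub>2 z * cnj w))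
      \<le> D * exp ((cmod z)\<^sup>2 / 2) * exp ((cmod w)\<^sup>2 / 2)" for z w
  proof -
    let ?k = "\<lambda>z. exp (z * cnj w)"
    have "cmod (?T ?k z) \<le> (K * (B * (G * exp (p * (cmod w)\<^sup>2 / 2)) powr (q / p))) powr (1 / q) * exp ((cmod z)\<^sup>2 / 2)"
      using sub G(2)[of w] B(2)[OF G(2)[of w]] unfolding G(3) by (intro K(2)) auto
    also have "(G * exp (p * (cmod w)\<^sup>2 / 2)) powr (q / p) = G powr (q / p) * exp (q * (cmod w)\<^sup>2 / 2)"
      using p by (simp add: powr_mult exp_powr_real)
    also have "(K * (B * (G powr (q / p) * exp (q * (cmod w)\<^sup>2 / 2)))) powr (1 / q)
        = (K * B * G powr (q / p) * exp (q * (cmod w)\<^sup>2 / 2)) powr (1 / q)"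
      by (simp add: mult.assoc)
    also have "\<dots> = D * exp ((cmod w)\<^sup>2 / 2)"
      unfolding D_def using q by (subst powr_mult) (simp add: exp_powr_real)
    finally show ?thesis by (simp add: comp_op_def mult_ac)
  qed
  define C where "C = (exp 1 + 1) * exp (1 / 2) * D / cmod c\<^sub>1 + 1"
  have "0 \<le> D" by (simp add: D_def)
  then have C0: "0 < C" by (auto simp: C_def intro!: add_nonneg_pos divide_nonneg_nonneg mult_nonneg_nonneg)
  have "min 1 (cmod (\<phi>\<^sub>1 z - \<phi>\<^sub>2 z)) * exp ((cmod (\<phi>\<^sub>1 z))\<^sup>2 / 2) \<le> C * exp ((cmod z)\<^sup>2 / 2)" for z
  proof -
    have "cmod c\<^sub>1 * min 1 (cmod (\<phi>\<^sub>1 z - \<phi>\<^sub>2 z)) * exp ((cmod (\<phi>\<^sub>1 z))\<^sup>2 / 2)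
      \<le> (exp 1 + 1) * exp (1 / 2) * (D * exp ((cmod z)\<^sup>2 / 2))"
      using bound[of z] by (intro kernel_pair_separation) auto
    then have "min 1 (cmod (\<phi>\<^sub>1 z - \<phi>\<^sub>2 z)) * exp ((cmod (\<phi>\<^sub>1 z))\<^sup>2 / 2) \<le> (C - 1) * exp ((cmod z)\<^sup>2 / 2)"
      using c by (simp add: C_def pos_le_divide_eq mult_ac)
    also have "\<dots> \<le> C * exp ((cmod z)\<^sup>2 / 2)" by simp
    finally show ?thesis .
  qed
  with C0 that show ?thesis by blast
qed

section \<open>Linear growth and affine symbols\<close>

lemma entire_linear_growth_affine:
  assumes "\<phi> holomorphic_on UNIV" and "\<And>z. A \<le> cmod z \<Longrightarrow> cmod (\<phi> z) \<le> B * cmod z"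
  obtains a b where "\<phi> = (\<lambda>z. a * z + b)"
proof -
  have "\<phi> z = deriv \<phi> 0 * z + \<phi> 0" for z
    using Liouville_polynomial[of \<phi> A B 1 z] assms by (simp add: add.commute)
  then show ?thesis using that[of "deriv \<phi> 0" "\<phi> 0"] by blast
qed

lemma affine_bounded_below:
  fixes a b :: complex
  assumes "a \<noteq> 0 \<or> b \<noteq> 0"
  obtains A c where "0 < c" "c \<le> 1" "\<And>z. A \<le> cmod z \<Longrightarrow> c \<le> cmod (a * z + b)"
proof (cases "a = 0")
  case True
  then show ?thesis using assms by (intro that[of "min 1 (cmod b)" 0]) auto
next
  case False
  show ?thesis
  proof (rule that[of 1 "(cmod b + 1) / cmod a"])
    fix z assume "(cmod b + 1) / cmod a \<le> cmod z"
    then have "cmod b + 1 \<le> cmod (a * z)"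
      using False by (simp add: norm_mult divide_le_eq mult.commute)
    then show "1 \<le> cmod (a * z + b)" using norm_diff_ineq[of "a * z" b] by linarith
  qed auto
qed

text \<open>On the ray where \<open>a * z\<close> and \<open>b\<close> point in the same direction
  the modulus is \<open>cmod a * t + cmod b\<close>. Its square exceeds \<open>t\<^sup>2\<close> by
  a bounded amount only if \<open>cmod a < 1\<close>, or if \<open>cmod a = 1\<close> and the cross
  term \<open>2 * cmod b * t\<close> vanishes.\<close>

lemma affine_growth_contraction:
  fixes a b :: complex
  assumes gr: "\<And>z. A \<le> cmod z \<Longrightarrow> (cmod (a * z + b))\<^sup>2 \<le> (cmod z)\<^sup>2 + M"
  shows "cmod a < 1 \<or> cmod a = 1 \<and> b = 0"
proof (rule ccontr)
  assume neg: "\<not> ?thesis"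
  \<comment> \<open>The unit vector that turns \<open>a\<close> into the direction of
    \<open>b\<close>; if one of them is 0, every direction serves and 1 is taken.\<close>
  define v where "v = (if a = 0 \<or> b = 0 then 1 else sgn b * cnj (sgn a))"
  have "cmod v = 1" by (simp add: v_def norm_mult norm_sgn)
  have aligned: "cmod (a * (of_real t * v) + b) = cmod a * t + cmod b" if t: "0 \<le> t" for t :: real
  proof (cases "a = 0 \<or> b = 0")
    case True
    then show ?thesis using t by (auto simp: v_def norm_mult)
  next
    case False
    have asgn: "a * cnj (sgn a) = of_real (cmod a)"
      using complex_norm_square[of a] False
      by (simp add: sgn_div_norm scaleR_conv_of_real power2_eq_square field_simps)
    have bsgn: "sgn b * of_real (cmod b) = b"
      using False by (simp add: sgn_div_norm scaleR_conv_of_real)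
    have "a * (of_real t * v) + b = sgn b * of_real (cmod a * t) + sgn b * of_real (cmod b)"
      using False asgn bsgn by (simp add: v_def mult_ac)
    also have "\<dots> = sgn b * of_real (cmod a * t + cmod b)" by (simp add: distrib_left)
    finally have "cmod (a * (of_real t * v) + b) = cmod (sgn b) * \<bar>cmod a * t + cmod b\<bar>"
      by (simp only: norm_mult norm_of_real)
    then show ?thesis using False t by (simp add: norm_sgn)
  qed
  have *: "(cmod a * t + cmod b)\<^sup>2 \<le> t\<^sup>2 + M" if "\<bar>A\<bar> \<le> t" for t
    using gr[of "of_real t * v"] that aligned[of t] \<open>cmod v = 1\<close> by (simp add: norm_mult)
  have a1: "1 \<le> cmod a" using neg by auto
  \<comment> \<open>Under the negated claim \<open>s\<close> is positive, and for
    \<open>t \<ge> 1\<close> the modulus on the ray is at least \<open>t + s\<close>. The point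
    \<open>t\<close> lies beyond \<open>A\<close> and is large enough for \<open>s * t\<close> to
    exceed \<open>M\<close>.\<close>
  define s where "s = (cmod a - 1) + cmod b"
  have s: "0 < s" using neg a1 by (auto simp: s_def intro: add_pos_nonneg add_nonneg_pos)
  define t where "t = max \<bar>A\<bar> (max 1 ((\<bar>M\<bar> + 1) / s))"
  have t: "\<bar>A\<bar> \<le> t" "1 \<le> t" "(\<bar>M\<bar> + 1) / s \<le> t" by (auto simp: t_def)
  have "t + s \<le> cmod a * t + cmod b"
    using mult_left_mono[OF t(2), of "cmod a - 1"] a1 by (simp add: s_def algebra_simps)
  then have "(t + s)\<^sup>2 \<le> (cmod a * t + cmod b)\<^sup>2" using t s by (intro power_mono) auto
  with *[OF t(1)] have "2 * (s * t) + s\<^sup>2 \<le> M" by (simp add: power2_eq_square algebra_simps)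
  moreover have "\<bar>M\<bar> + 1 \<le> s * t" using t(3) s by (simp add: divide_le_eq mult.commute)
  ultimately show False by (smt (verit) zero_le_power2)
qed

text \<open>Once the difference of the symbols is bounded below near infinity, the minimum in
  \<open>gr1\<close> is at least a constant, and logarithms turn \<open>gr1\<close> into a
  comparison of squares. Only \<open>\<phi>\<^sub>1\<close> is treated; exchanging the symbols gives
  \<open>\<phi>\<^sub>2\<close>.\<close>

lemma separated_growth_affine:
  fixes \<phi>\<^sub>1 \<phi>\<^sub>2 :: "complex \<Rightarrow> complex"
  assumes hol: "\<phi>\<^sub>1 holomorphic_on UNIV" "\<phi>\<^sub>2 holomorphic_on UNIV" and ne: "\<phi>\<^sub>1 \<noteq> \<phi>\<^sub>2"
    and C: "0 < C"
    and gr1: "\<And>z. min 1 (cmod (\<phi>\<^sub>1 z - \<phi>\<^sub>2 z)) * exp ((cmod (\<phi>\<^sub>1 z))\<^sup>2 / 2) \<le> C * exp ((cmod z)\<^sup>2 / 2)"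
    and gr2: "\<And>z. min 1 (cmod (\<phi>\<^sub>1 z - \<phi>\<^sub>2 z)) * exp ((cmod (\<phi>\<^sub>2 z))\<^sup>2 / 2) \<le> C * exp ((cmod z)\<^sup>2 / 2)"
  obtains a b where "\<phi>\<^sub>1 = (\<lambda>z. a * z + b)" "cmod a < 1 \<or> cmod a = 1 \<and> b = 0"
proof -
  have sq: "x\<^sup>2 \<le> y\<^sup>2 + 2 * ln (C / c)"
    if "0 < c" "c * exp (x\<^sup>2 / 2) \<le> C * exp (y\<^sup>2 / 2)" for x y c :: real
  proof -
    have "exp (x\<^sup>2 / 2) \<le> exp (y\<^sup>2 / 2) * (C / c)"
      using that by (simp add: field_simps)
    also have "\<dots> = exp (y\<^sup>2 / 2 + ln (C / c))"
      using that(1) C by (simp add: exp_add)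
    finally have "x\<^sup>2 / 2 \<le> y\<^sup>2 / 2 + ln (C / c)" by (simp only: exp_le_cancel_iff)
    then show ?thesis by linarith
  qed
  have lin: "x \<le> y + (\<bar>M\<bar> + 1)" if "x\<^sup>2 \<le> y\<^sup>2 + M" "0 \<le> y" for x y M :: real
  proof (rule power2_le_imp_le)
    have "M \<le> \<bar>M\<bar> * \<bar>M\<bar> + 2 * \<bar>M\<bar> + 1"
      using abs_ge_self[of M] abs_ge_zero[of M] zero_le_square[of "\<bar>M\<bar>"] by linarith
    then have "M \<le> (\<bar>M\<bar> + 1)\<^sup>2" by (simp add: power2_eq_square algebra_simps)
    then have "x\<^sup>2 \<le> y\<^sup>2 + (\<bar>M\<bar> + 1)\<^sup>2 + 2 * (y * (\<bar>M\<bar> + 1))"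
      using that by (smt (verit) mult_nonneg_nonneg)
    then show "x\<^sup>2 \<le> (y + (\<bar>M\<bar> + 1))\<^sup>2" by (simp add: power2_sum algebra_simps)
  qed (use that in auto)
  define M where "M = \<bar>2 * ln (C / 1)\<bar> + 1"
  have M: "0 \<le> M" by (simp add: M_def)
  \<comment> \<open>Where the difference is at least 1, the two growth bounds apply at full strength and
    control it; so the difference is affine, hence bounded below near infinity.\<close>
  have lg: "cmod (\<phi>\<^sub>1 z - \<phi>\<^sub>2 z) \<le> (2 * M + 3) * cmod z" if z: "1 \<le> cmod z" for z
  proof (cases "1 \<le> cmod (\<phi>\<^sub>1 z - \<phi>\<^sub>2 z)")
    case True
    then have "cmod (\<phi>\<^sub>1 z) \<le> cmod z + M" "cmod (\<phi>\<^sub>2 z) \<le> cmod z + M"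
      using sq[of 1 "cmod (\<phi>\<^sub>1 z)" "cmod z"] sq[of 1 "cmod (\<phi>\<^sub>2 z)" "cmod z"] gr1[of z] gr2[of z]
      unfolding M_def by (auto intro!: lin)
    then have "cmod (\<phi>\<^sub>1 z - \<phi>\<^sub>2 z) \<le> 2 * cmod z + 2 * M"
      using norm_triangle_ineq4[of "\<phi>\<^sub>1 z" "\<phi>\<^sub>2 z"] by linarith
    also have "2 * M \<le> 2 * M * cmod z" using M z by (simp add: mult_le_cancel_left1)
    finally show ?thesis using z by (simp add: distrib_right)
  next
    case False
    have "1 * 1 \<le> (2 * M + 3) * cmod z" using M z by (intro mult_mono) auto
    with False show ?thesis by linarith
  qed
  obtain a b where ab: "(\<lambda>z. \<phi>\<^sub>1 z - \<phi>\<^sub>2 z) = (\<lambda>z. a * z + b)"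
    using entire_linear_growth_affine[OF holomorphic_on_diff[OF hol] lg] by blast
  have nz: "a \<noteq> 0 \<or> b \<noteq> 0"
  proof (rule ccontr)
    assume "\<not> ?thesis"
    then have "\<phi>\<^sub>1 z - \<phi>\<^sub>2 z = 0" for z using fun_cong[OF ab, of z] by simp
    then show False using ne by auto
  qed
  obtain A c where c: "0 < c" "c \<le> 1" "\<And>z. A \<le> cmod z \<Longrightarrow> c \<le> cmod (a * z + b)"
    by (rule affine_bounded_below[OF nz]) (rule that)
  define N where "N = 2 * ln (C / c)"
  \<comment> \<open>The bound between squares is kept beside its linear consequence
    \<open>lg1\<close>: the latter makes \<open>\<phi>\<^sub>1\<close> affine, but for
    \<open>cmod a' = 1\<close> it would not force \<open>b' = 0\<close>.\<close>
  have N: "(cmod (\<phi>\<^sub>1 z))\<^sup>2 \<le> (cmod z)\<^sup>2 + N" if "A \<le> cmod z" for z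
    unfolding N_def
  proof (rule sq[OF c(1)])
    have "c * exp ((cmod (\<phi>\<^sub>1 z))\<^sup>2 / 2) \<le> min 1 (cmod (\<phi>\<^sub>1 z - \<phi>\<^sub>2 z)) * exp ((cmod (\<phi>\<^sub>1 z))\<^sup>2 / 2)"
      using c(2) c(3)[OF that] fun_cong[OF ab, of z] by (intro mult_right_mono) auto
    with gr1[of z] show "c * exp ((cmod (\<phi>\<^sub>1 z))\<^sup>2 / 2) \<le> C * exp ((cmod z)\<^sup>2 / 2)" by linarith
  qed
  have lg1: "cmod (\<phi>\<^sub>1 z) \<le> (\<bar>N\<bar> + 2) * cmod z" if "max A 1 \<le> cmod z" for z
  proof -
    have z: "A \<le> cmod z" "1 \<le> cmod z" using that by auto
    have "cmod (\<phi>\<^sub>1 z) \<le> cmod z + (\<bar>N\<bar> + 1)" by (rule lin[OF N[OF z(1)]]) auto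
    also have "\<bar>N\<bar> + 1 \<le> (\<bar>N\<bar> + 1) * cmod z" using z(2) by (simp add: mult_le_cancel_left1)
    finally show ?thesis by (simp add: algebra_simps)
  qed
  obtain a' b' where *: "\<phi>\<^sub>1 = (\<lambda>z. a' * z + b')"
    using entire_linear_growth_affine[OF hol(1) lg1] by blast
  moreover have "cmod a' < 1 \<or> cmod a' = 1 \<and> b' = 0"
    by (rule affine_growth_contraction[of A _ _ N]) (use N * in auto)
  ultimately show ?thesis using that by blast
qed

text \<open>Every monomial \<open>z ^ n\<close> is an eigenfunction, with eigenvalue
  \<open>s n\<close>. The estimate compares \<open>sqrt n\<close> with its power
  \<open>q / p < 1\<close> and so forces the eigenvalues to 0, which \<open>cmod a = 1\<close> and
  \<open>a \<noteq> b\<close> exclude. With \<open>d = 0\<close> this covers a single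
  rotation.\<close>

lemma not_fock_estimate_unimodular:
  fixes a b c d :: complex
  assumes q: "0 < q" "q < p" and a: "cmod a = 1" and b: "cmod b \<le> 1" "a \<noteq> b" and c: "c \<noteq> 0"
  shows "\<not> fock_estimate p q (\<lambda>f z. c * comp_op (\<lambda>z. a * z) f z + d * comp_op (\<lambda>z. b * z) f z)"
proof
  let ?T = "\<lambda>f z. c * comp_op (\<lambda>z. a * z) f z + d * comp_op (\<lambda>z. b * z) f z"
  assume "fock_estimate p q ?T"
  then obtain B where B: "0 \<le> B" "\<And>f. f \<in> fock_space p \<Longrightarrow> (\<integral>z. fock_density q (?T f) z \<partial>lborel)
        \<le> B * (\<integral>z. fock_density p f z \<partial>lborel) powr (q / p)"
    by (auto simp: fock_estimate_def)
  have p: "0 < p" using q by simp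
  define m where "m n = sqrt (real n) ^ n * exp (- (real n / 2))" for n
  obtain C where C: "0 < C"
    "\<And>n. 1 \<le> n \<Longrightarrow> (\<lambda>z. z ^ n) \<in> fock_space p"
    "\<And>n. 1 \<le> n \<Longrightarrow> (\<integral>z. fock_density p (\<lambda>z. z ^ n) z \<partial>lborel) \<le> m n powr p * (C * (1 + sqrt n))"
    using fock_monomial_upper[OF p] unfolding m_def by metis
  have memq: "(\<lambda>z. z ^ n) \<in> fock_space q" if "1 \<le> n" for n
    using fock_monomial_upper[OF q(1)] that by metis
  define \<kappa> where "\<kappa> = exp (- (3 / 2 * q)) * (2 * pi)"
  have \<kappa>: "0 < \<kappa>" by (simp add: \<kappa>_def)
  have low: "m n powr q * (\<kappa> * sqrt n) \<le> (\<integral>z. fock_density q (\<lambda>z. z ^ n) z \<partial>lborel)" if "1 \<le> n" for n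
    using fock_monomial_lower[OF q(1) that memq[OF that]] by (simp add: m_def \<kappa>_def mult_ac)
  define s where "s n = c * a ^ n + d * b ^ n" for n
  define \<theta> where "\<theta> = q / p"
  have \<theta>: "0 < \<theta>" "\<theta> < 1" using q by (auto simp: \<theta>_def)
  define D where "D = B * C powr \<theta>"
  have D: "0 \<le> D" using B(1) by (simp add: D_def)
  have est: "cmod (s n) powr q * \<kappa> * sqrt n \<le> D * (1 + sqrt n) powr \<theta>" if n: "1 \<le> n" for n
  proof -
    have m0: "0 < m n" using n by (simp add: m_def)
    have "?T (\<lambda>z. z ^ n) = (\<lambda>z. s n * z ^ n)"
      by (simp add: s_def comp_op_def fun_eq_iff power_mult_distrib algebra_simps)
    then have "cmod (s n) powr q * (\<integral>z. fock_density q (\<lambda>z. z ^ n) z \<partial>lborel)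
        \<le> B * (\<integral>z. fock_density p (\<lambda>z. z ^ n) z \<partial>lborel) powr (q / p)"
      using B(2)[OF C(2)[OF n]] by (simp only: integral_fock_density_cmult)
    moreover have "cmod (s n) powr q * (m n powr q * (\<kappa> * sqrt n))
        \<le> cmod (s n) powr q * (\<integral>z. fock_density q (\<lambda>z. z ^ n) z \<partial>lborel)"
      by (intro mult_left_mono low n) auto
    moreover have "B * (\<integral>z. fock_density p (\<lambda>z. z ^ n) z \<partial>lborel) powr (q / p)
        \<le> B * (m n powr p * (C * (1 + sqrt n))) powr (q / p)"
      using p q by (intro mult_left_mono[OF _ B(1)] powr_mono2 C(3)[OF n])
        (auto simp: integral_fock_density_nonneg)
    \<comment> \<open>The peak value \<open>m n\<close> occurs to the power \<open>q\<close> on both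
      sides and cancels; what remains is \<open>sqrt n\<close> against
      \<open>(1 + sqrt n) powr \<theta>\<close>.\<close>
    moreover have "(m n powr p * (C * (1 + sqrt n))) powr (q / p)
        = m n powr q * (C powr \<theta> * (1 + sqrt n) powr \<theta>)"
      using p by (simp add: powr_mult powr_powr \<theta>_def)
    ultimately have "m n powr q * (cmod (s n) powr q * \<kappa> * sqrt n) \<le> m n powr q * (D * (1 + sqrt n) powr \<theta>)"
      by (simp add: D_def mult_ac)
    then show ?thesis using m0 by simp
  qed
  \<comment> \<open>Half of the modulus of \<open>s (Suc n) - b * s n\<close>, in which the terms
    with \<open>d\<close> cancel.\<close>
  define \<delta> where "\<delta> = cmod c * cmod (a - b) / 2"
  have \<delta>: "0 < \<delta>" using b c by (simp add: \<delta>_def)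
  \<comment> \<open>The coefficients may cancel for some \<open>n\<close>, but not for two consecutive ones.\<close>
  have alt: "\<delta> \<le> cmod (s n) \<or> \<delta> \<le> cmod (s (Suc n))" for n
  proof -
    have "s (Suc n) - b * s n = c * a ^ n * (a - b)" by (simp add: s_def algebra_simps)
    then have "2 * \<delta> = cmod (s (Suc n) - b * s n)"
      using a by (simp add: \<delta>_def norm_mult norm_power)
    also have "\<dots> \<le> cmod (s (Suc n)) + cmod b * cmod (s n)"
      by (metis norm_mult norm_triangle_ineq4)
    also have "\<dots> \<le> cmod (s (Suc n)) + cmod (s n)"
      using b(1) by (simp add: mult_left_le_one_le)
    finally show ?thesis by linarith
  qed
  \<comment> \<open>Here \<open>q < p\<close> enters: \<open>\<theta> < 1\<close> makes the quotient
    tend to 0.\<close>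
  have "(\<lambda>n::nat. D * ((1 + sqrt n) powr \<theta> / sqrt n)) \<longlonglongrightarrow> D * 0"
    using \<theta> by (intro tendsto_mult tendsto_const) real_asymp
  then have "\<forall>\<^sub>F n in sequentially. D * ((1 + sqrt n) powr \<theta> / sqrt n) < \<delta> powr q * \<kappa>"
    using \<delta> \<kappa> by (intro order_tendstoD(2)) auto
  then obtain N :: nat where N: "\<And>n. N \<le> n \<Longrightarrow> D * ((1 + sqrt n) powr \<theta> / sqrt n) < \<delta> powr q * \<kappa>"
    by (auto simp: eventually_sequentially)
  obtain n where n: "N \<le> n" "1 \<le> n" "\<delta> \<le> cmod (s n)"
    using alt[of "max N 1"] by (metis le_Suc_eq max.bounded_iff max.cobounded1 max.cobounded2)
  have "D * (1 + sqrt n) powr \<theta> < \<delta> powr q * \<kappa> * sqrt n"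
    using N[OF n(1)] n(2) by (simp add: divide_less_eq)
  also have "\<dots> \<le> cmod (s n) powr q * \<kappa> * sqrt n"
    using n(3) \<delta> \<kappa> q by (intro mult_right_mono powr_mono2) auto
  also have "\<dots> \<le> D * (1 + sqrt n) powr \<theta>" by (rule est[OF n(2)])
  finally show False by simp
qed

text \<open>The growth bounds leave only strict contractions and rotations about 0 for each symbol.
  A rotation \<open>\<phi>\<^sub>1\<close> is excluded by monomials, either paired with a second
  rotation or after subtracting the operator of a contraction \<open>\<phi>\<^sub>2\<close>.\<close>

lemma fock_estimate_contraction:
  fixes \<phi>\<^sub>1 \<phi>\<^sub>2 :: "complex \<Rightarrow> complex"
  assumes q: "0 < q" "q < p"
    and hol: "\<phi>\<^sub>1 holomorphic_on UNIV" "\<phi>\<^sub>2 holomorphic_on UNIV" and ne: "\<phi>\<^sub>1 \<noteq> \<phi>\<^sub>2"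
    and c: "c\<^sub>1 \<noteq> 0" "c\<^sub>2 \<noteq> 0"
    and T: "fock_estimate p q (\<lambda>f z. c\<^sub>1 * comp_op \<phi>\<^sub>1 f z + c\<^sub>2 * comp_op \<phi>\<^sub>2 f z)"
  obtains a b where "\<phi>\<^sub>1 = (\<lambda>z. a * z + b)" "cmod a < 1"
proof -
  have p: "0 < p" using q by simp
  have T': "fock_estimate p q (\<lambda>f z. c\<^sub>2 * comp_op \<phi>\<^sub>2 f z + c\<^sub>1 * comp_op \<phi>\<^sub>1 f z)"
    using T by (simp add: add.commute)
  obtain C\<^sub>1 where C1: "0 < C\<^sub>1"
    "\<And>z. min 1 (cmod (\<phi>\<^sub>1 z - \<phi>\<^sub>2 z)) * exp ((cmod (\<phi>\<^sub>1 z))\<^sup>2 / 2) \<le> C\<^sub>1 * exp ((cmod z)\<^sup>2 / 2)"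
    using fock_estimate_separation[OF p q(1) c(1) T] by blast
  obtain C\<^sub>2 where C2: "0 < C\<^sub>2"
    "\<And>z. min 1 (cmod (\<phi>\<^sub>2 z - \<phi>\<^sub>1 z)) * exp ((cmod (\<phi>\<^sub>2 z))\<^sup>2 / 2) \<le> C\<^sub>2 * exp ((cmod z)\<^sup>2 / 2)"
    using fock_estimate_separation[OF p q(1) c(2) T'] by blast
  define C where "C = max C\<^sub>1 C\<^sub>2"
  have C: "0 < C" using C1 by (simp add: C_def less_max_iff_disj)
  have gr1: "min 1 (cmod (\<phi>\<^sub>1 z - \<phi>\<^sub>2 z)) * exp ((cmod (\<phi>\<^sub>1 z))\<^sup>2 / 2) \<le> C * exp ((cmod z)\<^sup>2 / 2)" for z
    by (rule order_trans[OF C1(2)]) (simp add: C_def)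
  have gr2: "min 1 (cmod (\<phi>\<^sub>2 z - \<phi>\<^sub>1 z)) * exp ((cmod (\<phi>\<^sub>2 z))\<^sup>2 / 2) \<le> C * exp ((cmod z)\<^sup>2 / 2)" for z
    by (rule order_trans[OF C2(2)]) (simp add: C_def)
  obtain a\<^sub>1 b\<^sub>1 where 1: "\<phi>\<^sub>1 = (\<lambda>z. a\<^sub>1 * z + b\<^sub>1)" "cmod a\<^sub>1 < 1 \<or> cmod a\<^sub>1 = 1 \<and> b\<^sub>1 = 0"
    using separated_growth_affine[OF hol ne C gr1 gr2[unfolded norm_minus_commute[of "\<phi>\<^sub>2 _"]]] by blast
  obtain a\<^sub>2 b\<^sub>2 where 2: "\<phi>\<^sub>2 = (\<lambda>z. a\<^sub>2 * z + b\<^sub>2)" "cmod a\<^sub>2 < 1 \<or> cmod a\<^sub>2 = 1 \<and> b\<^sub>2 = 0"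
    using separated_growth_affine[OF hol(2,1) ne[symmetric] C gr2 gr1[unfolded norm_minus_commute[of "\<phi>\<^sub>1 _"]]] by blast
  have "cmod a\<^sub>1 < 1"
  proof (rule ccontr)
    assume "\<not> cmod a\<^sub>1 < 1"
    then have a1: "cmod a\<^sub>1 = 1" "b\<^sub>1 = 0" using 1(2) by auto
    have \<phi>1: "\<phi>\<^sub>1 = (\<lambda>z. a\<^sub>1 * z)" using 1(1) a1 by simp
    from 2(2) show False
    proof
      assume a2: "cmod a\<^sub>2 < 1"
      have "fock_estimate p q (comp_op \<phi>\<^sub>2)" unfolding 2(1) by (rule fock_estimate_affine[OF p q(1) a2])
      \<comment> \<open>The subtraction leaves \<open>c\<^sub>1 * comp_op \<phi>\<^sub>1\<close>.
        The summand with coefficient \<open>0\<close> and symbol \<open>0 * z\<close> only gives it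
        the two-term shape of the monomial argument.\<close>
      from fock_estimate_lincomb[OF q(1) T this, of 1 "- c\<^sub>2"]
      have "fock_estimate p q (\<lambda>f z. c\<^sub>1 * comp_op (\<lambda>z. a\<^sub>1 * z) f z + 0 * comp_op (\<lambda>z. 0 * z) f z)"
        by (simp add: \<phi>1)
      with not_fock_estimate_unimodular[OF q a1(1), of 0 c\<^sub>1 0] a1(1) c show False by force
    next
      assume a2: "cmod a\<^sub>2 = 1 \<and> b\<^sub>2 = 0"
      then have \<phi>2: "\<phi>\<^sub>2 = (\<lambda>z. a\<^sub>2 * z)" using 2(1) by simp
      have "a\<^sub>1 \<noteq> a\<^sub>2" using ne \<phi>1 \<phi>2 by auto
      with not_fock_estimate_unimodular[OF q a1(1), of a\<^sub>2 c\<^sub>1 c\<^sub>2] a2 c T show False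
        unfolding \<phi>1 \<phi>2 by simp
    qed
  qed
  with 1(1) that show ?thesis by blast
qed

theorem theorem1p5:
  fixes p q :: real
    and \<phi>\<^sub>1 \<phi>\<^sub>2 :: "complex \<Rightarrow> complex"
    and c\<^sub>1 c\<^sub>2 :: complex
  assumes "0 < q" and "q < p"
    and "\<phi>\<^sub>1 holomorphic_on UNIV" and "\<phi>\<^sub>2 holomorphic_on UNIV"
    and "\<phi>\<^sub>1 \<noteq> \<phi>\<^sub>2"
    and "c\<^sub>1 \<noteq> 0" and "c\<^sub>2 \<noteq> 0"
  shows "(fock_bounded_op p q (\<lambda>f z. c\<^sub>1 * comp_op \<phi>\<^sub>1 f z + c\<^sub>2 * comp_op \<phi>\<^sub>2 f z) \<longleftrightarrow>
          fock_compact_op p q (\<lambda>f z. c\<^sub>1 * comp_op \<phi>\<^sub>1 f z + c\<^sub>2 * comp_op \<phi>\<^sub>2 f z)) \<and>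
         (fock_compact_op p q (\<lambda>f z. c\<^sub>1 * comp_op \<phi>\<^sub>1 f z + c\<^sub>2 * comp_op \<phi>\<^sub>2 f z) \<longleftrightarrow>
          fock_compact_op p q (comp_op \<phi>\<^sub>1) \<and> fock_compact_op p q (comp_op \<phi>\<^sub>2))"
proof -
  let ?T = "\<lambda>f z. c\<^sub>1 * comp_op \<phi>\<^sub>1 f z + c\<^sub>2 * comp_op \<phi>\<^sub>2 f z"
  have p: "0 < p" using assms by simp
  have estT: "fock_bounded_op p q ?T \<longleftrightarrow> fock_estimate p q ?T"
    by (rule fock_bounded_op_iff_estimate[OF p assms(1)])
      (simp add: comp_op_def fun_eq_iff algebra_simps)
  have estC: "fock_bounded_op p q (comp_op \<phi>) \<longleftrightarrow> fock_estimate p q (comp_op \<phi>)" for \<phi>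
    by (rule fock_bounded_op_iff_estimate[OF p assms(1)]) (simp add: comp_op_def fun_eq_iff)
  \<comment> \<open>The estimate is the hub: it makes both symbols strict contractions and thereby
    yields every compactness claim, while \<open>2\<close> and \<open>3\<close> lead back to
    it.\<close>
  have 1: "fock_compact_op p q ?T \<and> fock_compact_op p q (comp_op \<phi>\<^sub>1) \<and> fock_compact_op p q (comp_op \<phi>\<^sub>2)"
    if T: "fock_estimate p q ?T"
  proof -
    have T': "fock_estimate p q (\<lambda>f z. c\<^sub>2 * comp_op \<phi>\<^sub>2 f z + c\<^sub>1 * comp_op \<phi>\<^sub>1 f z)"
      using T by (simp add: add.commute)
    obtain a\<^sub>1 b\<^sub>1 where 1: "\<phi>\<^sub>1 = (\<lambda>z. a\<^sub>1 * z + b\<^sub>1)" "cmod a\<^sub>1 < 1"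
      using fock_estimate_contraction[OF assms T] by blast
    obtain a\<^sub>2 b\<^sub>2 where 2: "\<phi>\<^sub>2 = (\<lambda>z. a\<^sub>2 * z + b\<^sub>2)" "cmod a\<^sub>2 < 1"
      using fock_estimate_contraction[OF assms(1,2,4,3) assms(5)[symmetric] assms(7,6) T'] by blast
    have compact: "fock_compact_op p q (\<lambda>f z. k\<^sub>1 * comp_op \<phi>\<^sub>1 f z + k\<^sub>2 * comp_op \<phi>\<^sub>2 f z)" for k\<^sub>1 k\<^sub>2
      unfolding 1(1) 2(1) by (rule fock_compact_op_affine[OF p assms(1) 1(2) 2(2)])
    from compact[of 1 0] compact[of 0 1] compact[of c\<^sub>1 c\<^sub>2] show ?thesis by simp
  qed
  have 2: "fock_estimate p q ?T" if "fock_compact_op p q ?T"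
    using fock_compact_op_imp_bounded[OF assms(1) that] estT by simp
  have 3: "fock_estimate p q ?T"
    if "fock_compact_op p q (comp_op \<phi>\<^sub>1)" "fock_compact_op p q (comp_op \<phi>\<^sub>2)"
    using that[THEN fock_compact_op_imp_bounded[OF assms(1)]] fock_estimate_lincomb[OF assms(1)] estC
    by blast
  show ?thesis using 1 2 3 estT by blast
qed

end
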